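(* Let $q$ be a prime power and let $h(X)\in\mathbb{F}_q(X)$ be a nonconstant rational function whose ramification multiset over some point $\gamma\in\mathbb{P}^1(\overline{\mathbb{F}}_q)$ is $[s,t]$, where $s$ and $t$ are positive integers and $\gcd(t,q+1)=1$. Then $h(X)$ permutes $\mathbb{P}^1(\mathbb{F}_q)$ if and only if $s\equiv 0\pmod{q+1}$ and $\gamma\in\mathbb{F}_{q^2}\setminus\mathbb{F}_q$.
   Context: For a field $K$, $\mathbb{P}^1(K)=K\cup\{\infty\}$; a rational function in $K(X)$ (written in lowest terms) defines a function $\mathbb{P}^1(K)\to\mathbb{P}^1(K)$, and likewise over $\overline{K}$. "Permutes $\mathbb{P}^1(\mathbb{F}_q)$" means it induces a bijection of $\mathbb{P}^1(\mathbb{F}_q)$. For a nonconstant $h(X)\in\overline{\mathbb{F}}_q(X)$ and $\alpha\in\mathbb{P}^1(\overline{\mathbb{F}}_q)$, the ramification index $e_h(\alpha)$ is the multiplicity of $\alpha$ as an $h$-preimage of $h(\alpha)$: for any degree-one $\rho,\sigma\in\overline{\mathbb{F}}_q(X)$ with $\sigma(0)=\alpha$ and $\rho(h(\alpha))=0$, it is the degree of the lowest-degree term of the numerator of $\rho\circ h\circ\sigma$. The ramification multiset of $h$ over $\gamma$ is the multiset of all $e_h(\alpha)$ with $\alpha\in h^{-1}(\gamma)\subseteq\mathbb{P}^1(\overline{\mathbb{F}}_q)$; so it being $[s,t]$ means $\gamma$ has exactly two preimages, with ramification indices $s$ and $t$ (possibly $s=t$). Inseparable functions are allowed. *)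

theory Defs
  imports "HOL-Algebra.Algebraic_Closure_Type" "HOL-Number_Theory.Cong" "HOL-Library.Cardinality"
begin

text \<open>The rational functions \<open>K(X)\<close> are the type \<open>'a poly fract\<close>.\<close>

datatype 'a proj_line = Aff 'a | Infty

text \<open>Normalising the denominator to be monic makes the lowest-terms representation unique, so that
  it can be selected for every field without requiring a gcd class on it.\<close>

definition lowest_terms :: "'a::field poly fract \<Rightarrow> 'a poly \<times> 'a poly" where
  "lowest_terms f = (THE (a, b). f = Fraction_Field.Fract a b \<and> coprime a b \<and> lead_coeff b = 1)"

definition numer :: "'a::field poly fract \<Rightarrow> 'a poly" where
  "numer f = fst (lowest_terms f)"

definition denom :: "'a::field poly fract \<Rightarrow> 'a poly" where
  "denom f = snd (lowest_terms f)"

definition rat_degree :: "'a::field poly fract \<Rightarrow> nat" where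
  "rat_degree f = max (Polynomial.degree (numer f)) (Polynomial.degree (denom f))"

definition rat_const :: "'a::field \<Rightarrow> 'a poly fract" where
  "rat_const c = to_fract [:c:]"

text \<open>At infinity, the homogenisations of numerator and denominator of degree \<open>rat_degree f\<close> are
  evaluated at \<open>(1 : 0)\<close>, which leaves their coefficients of that degree.\<close>

fun rat_eval :: "'a::field poly fract \<Rightarrow> 'a proj_line \<Rightarrow> 'a proj_line" where
  "rat_eval f (Aff x) =
     (if poly (denom f) x = 0 then Infty else Aff (poly (numer f) x / poly (denom f) x))"
| "rat_eval f Infty =
     (let n = rat_degree f in
      if Polynomial.coeff (denom f) n = 0 then Infty
      else Aff (Polynomial.coeff (numer f) n / Polynomial.coeff (denom f) n))"

text \<open>Substitution of \<open>g\<close> into \<open>f\<close>. It is only used for nonconstant \<open>g\<close>; then \<open>g\<close> is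
  transcendental over the constants, and the denominator below does not vanish.\<close>

definition rat_comp :: "'a::field poly fract \<Rightarrow> 'a poly fract \<Rightarrow> 'a poly fract" where
  "rat_comp f g = poly (map_poly rat_const (numer f)) g / poly (map_poly rat_const (denom f)) g"

definition lowest_term_degree :: "'a::zero poly \<Rightarrow> nat" where
  "lowest_term_degree p = (LEAST i. Polynomial.coeff p i \<noteq> 0)"

text \<open>For nonconstant \<open>h\<close> the value does not depend on \<open>\<rho>\<close> and \<open>\<sigma>\<close>, and such \<open>\<rho>\<close>, \<open>\<sigma>\<close> exist.\<close>

definition ram_index :: "'a::field poly fract \<Rightarrow> 'a proj_line \<Rightarrow> nat" where
  "ram_index h \<alpha> = (THE e. \<forall>\<rho> \<sigma>.
     rat_degree \<rho> = 1 \<longrightarrow> rat_degree \<sigma> = 1 \<longrightarrow>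
     rat_eval \<sigma> (Aff 0) = \<alpha> \<longrightarrow> rat_eval \<rho> (rat_eval h \<alpha>) = Aff 0 \<longrightarrow>
     e = lowest_term_degree (numer (rat_comp \<rho> (rat_comp h \<sigma>))))"

text \<open>The fibre is finite for nonconstant \<open>h\<close>, as \<open>mset_set\<close> requires.\<close>

definition ram_multiset :: "'a::field poly fract \<Rightarrow> 'a proj_line \<Rightarrow> nat multiset" where
  "ram_multiset h \<gamma> = image_mset (ram_index h) (mset_set {\<alpha>. rat_eval h \<alpha> = \<gamma>})"

definition rat_to_ac :: "'a::field poly fract \<Rightarrow> 'a alg_closure poly fract" where
  "rat_to_ac f = Fraction_Field.Fract (map_poly to_ac (numer f)) (map_poly to_ac (denom f))"

text \<open>A field has at most one subfield with \<open>n\<close> elements; for \<open>n > 1\<close> a power of the characteristic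
  \<open>p > 0\<close>, an algebraically closed field has exactly one.\<close>

definition subfield_of_card :: "nat \<Rightarrow> 'a::field set" where
  "subfield_of_card n = (THE F. subfield F (ring_of_type_algebra :: 'a ring) \<and> card F = n)"

end

theory Submission
  imports Defs "HOL-Algebra.Sylow"
begin

text \<open>Let \<open>\<alpha>\<close> and \<open>\<beta>\<close> be the points over \<open>\<gamma>\<close>. If \<open>\<gamma>\<close> is rational, the Frobenius map permutes
  \<open>{\<alpha>, \<beta>}\<close>, so both points or neither of them are rational, and \<open>h\<close> is not a permutation.
  Otherwise the functions \<open>A \<delta> x = (x - \<delta> ^ q) / (x - \<delta>)\<close> are injective on the rational points and
  \<open>A \<gamma> (h x) = C (A \<alpha> x) ^ s (A \<beta> x) ^ t\<close> there. The values of \<open>A \<gamma>\<close> are the roots of a trinomial,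
  so that their power sums of exponent \<open>1, ..., q\<close> vanish, whereas the sum of \<open>(A \<alpha>) ^ r (A \<beta>)\<close>
  does not vanish for \<open>1 \<le> r \<le> q\<close>.

  If \<open>\<gamma>\<close> lies in the field of order \<open>q\<^sup>2\<close>, then exponents only matter modulo \<open>q + 1\<close>. Raising to the
  inverse of \<open>t\<close> modulo \<open>q + 1\<close> reduces to the case \<open>t = 1\<close>, and the sums show that a permutation
  requires \<open>q + 1\<close> to divide \<open>s\<close>. If \<open>\<gamma>\<close> does not lie in that field, then the numerators of
  \<open>h - \<gamma>\<close>, \<open>h - \<gamma> ^ q\<close> and \<open>h - \<gamma> ^ (q\<^sup>2)\<close> are pairwise coprime and linearly dependent. After
  extraction of a \<open>p\<close>-power root, where \<open>p\<close> is the characteristic, the Wronskian argument of Mason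
  and Stothers leaves only \<open>s + t \<le> 4\<close>, and there the same sums rule out a permutation.\<close>

section \<open>Power sums over the rational points of the projective line\<close>

text \<open>In the application \<open>'k\<close> is an algebraic closure and F is the copy of the
  finite field inside it. The sums below rest on these properties alone.\<close>

locale frobenius_field =
  fixes q :: nat and F :: "'k::field set"
  assumes q_ge_2: "q \<ge> 2"
    and frob_add: "\<And>x y :: 'k. (x + y) ^ q = x ^ q + y ^ q"
    and of_nat_q: "of_nat q = (0 :: 'k)"
    and F_eq: "F = {x. x ^ q = x}"
    and card_F: "card F = q"
begin

lemma frob_zero [simp]: "(0 :: 'k) ^ q = 0"
  using q_ge_2 by (simp add: power_0_left)

lemma frob_minus: "(- x :: 'k) ^ q = - (x ^ q)"
proof -
  have "x ^ q + (- x) ^ q = 0"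
    using frob_add[of x "- x"] by simp
  then show ?thesis
    by (simp add: add_eq_0_iff)
qed

lemma frob_diff: "(x - y :: 'k) ^ q = x ^ q - y ^ q"
  using frob_add[of x "- y"] by (simp add: frob_minus)

lemma frob_inj: "(x :: 'k) ^ q = y ^ q \<longleftrightarrow> x = y"
  using frob_diff[of x y] q_ge_2 by (metis eq_iff_diff_eq_0 frob_zero power_eq_0_iff)

lemma in_F_iff: "x \<in> F \<longleftrightarrow> x ^ q = x"
  by (simp add: F_eq)

lemma finite_F: "finite F"
  using card_F q_ge_2 by (intro card_ge_0_finite) simp

section \<open>Rational points and a degree-one function on them\<close>

definition PF :: "'k proj_line set" where
  "PF = insert Infty (Aff ` F)"

lemma finite_PF: "finite PF"
  by (simp add: PF_def finite_F)

lemma card_PF: "card PF = Suc q"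
  unfolding PF_def using finite_F card_F
  by (subst card_insert_disjoint) (auto simp: card_image inj_on_def)

lemma of_nat_card_PF: "of_nat (card PF) = (1 :: 'k)"
  by (simp add: card_PF of_nat_q)

text \<open>At a rational \<open>x\<close> this is \<open>(x - \<alpha>) ^ (q - 1)\<close>.\<close>

fun conj_quot :: "'k \<Rightarrow> 'k proj_line \<Rightarrow> 'k" where
  "conj_quot \<alpha> (Aff x) = (x - \<alpha> ^ q) / (x - \<alpha>)"
| "conj_quot \<alpha> Infty = 1"

text \<open>This is a Moebius transformation with nonzero determinant
  \<open>\<alpha> ^ q - \<alpha>\<close> and with its pole off \<open>PF\<close>. The value 1 is
  taken only at infinity.\<close>

lemma conj_quot_inj:
  assumes "\<alpha> \<notin> F"
  shows "inj_on (conj_quot \<alpha>) PF"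
proof -
  have ne: "\<alpha> ^ q \<noteq> \<alpha>" "\<And>x. x \<in> F \<Longrightarrow> x - \<alpha> \<noteq> 0"
    using assms by (auto simp: in_F_iff)
  have one: False if "conj_quot \<alpha> (Aff x) = 1" "x \<in> F" for x
    using that ne(1) ne(2)[of x] by (simp add: field_simps)
  have two: "x = y" if "conj_quot \<alpha> (Aff x) = conj_quot \<alpha> (Aff y)" "x \<in> F" "y \<in> F" for x y
  proof -
    have "(x - \<alpha> ^ q) * (y - \<alpha>) = (y - \<alpha> ^ q) * (x - \<alpha>)"
      using that ne(2)[of x] ne(2)[of y] by (simp add: field_simps)
    then have "(\<alpha> ^ q - \<alpha>) * (x - y) = 0"
      by (simp add: algebra_simps)
    with ne(1) show ?thesis
      by simp
  qed
  show ?thesis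
    unfolding PF_def by (auto intro!: inj_onI dest: one one[OF sym] two simp del: conj_quot.simps(1))
qed

text \<open>For \<alpha> outside F this equals
  \<open>(\<alpha> - \<alpha> ^ q) ^ (q - 1)\<close>.\<close>

definition kappa :: "'k \<Rightarrow> 'k" where
  "kappa \<alpha> = (\<alpha> ^ q - \<alpha> ^ (q ^ 2)) / (\<alpha> - \<alpha> ^ q)"

lemma frob_frob: "(\<alpha> ^ q) ^ q = (\<alpha> :: 'k) ^ (q ^ 2)"
  by (simp add: power2_eq_square flip: power_mult)

text \<open>As z is fixed by Frobenius, \<open>y ^ q\<close> is \<open>(z - b) / (z - a)\<close>,
  and the factor \<open>z - a\<close> cancels in \<open>y ^ Suc q\<close>. So 1, y and
  \<open>y ^ Suc q\<close> all lie in the span of 1 and \<open>1 / (z - \<alpha>)\<close>, which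
  forces a linear relation with constant coefficients.\<close>

lemma conj_quot_root:
  assumes "\<alpha> \<notin> F" "x \<in> PF"
  defines "y \<equiv> conj_quot \<alpha> x"
  shows "y ^ Suc q - (1 + kappa \<alpha>) * y + kappa \<alpha> = 0"
proof (cases x)
  case Infty
  then show ?thesis by (simp add: y_def)
next
  case (Aff z)
  then have z: "z ^ q = z" using assms by (auto simp: PF_def in_F_iff)
  define a b where "a = \<alpha> ^ q" and "b = \<alpha> ^ (q ^ 2)"
  have ne: "\<alpha> - a \<noteq> 0" "z - \<alpha> \<noteq> 0" "z - a \<noteq> 0"
    using assms z frob_inj[of z \<alpha>] unfolding a_def by (auto simp: in_F_iff Aff PF_def)
  have y: "y = (z - a) / (z - \<alpha>)"
    by (simp add: y_def Aff a_def)
  have "y ^ q = (z - b) / (z - a)"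
    unfolding y by (simp add: power_divide frob_diff z a_def b_def frob_frob)
  then have 1: "y ^ Suc q = (z - b) / (z - \<alpha>)"
    using ne by (simp add: y)
  have k: "kappa \<alpha> = (a - b) / (\<alpha> - a)"
    by (simp add: kappa_def a_def b_def)
  have k1: "1 + kappa \<alpha> = (\<alpha> - b) / (\<alpha> - a)"
    unfolding k using ne(1) by (simp add: add_divide_eq_iff)
  have "(z - b) * (\<alpha> - a) - (\<alpha> - b) * (z - a) + (a - b) * (z - \<alpha>) = 0"
    by (simp add: algebra_simps)
  moreover have "y ^ Suc q - (1 + kappa \<alpha>) * y + kappa \<alpha> =
      ((z - b) * (\<alpha> - a) - (\<alpha> - b) * (z - a) + (a - b) * (z - \<alpha>)) / ((z - \<alpha>) * (\<alpha> - a))"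
    unfolding 1 k1 unfolding k y using ne by (simp add: divide_simps) (simp add: algebra_simps)?
  ultimately show ?thesis by simp
qed

section \<open>Power sums of the values of \<open>conj_quot \<alpha>\<close>\<close>

definition psum :: "'k \<Rightarrow> nat \<Rightarrow> 'k" where
  "psum \<alpha> k = (\<Sum>x\<in>PF. conj_quot \<alpha> x ^ k)"

lemma psum_0: "psum \<alpha> 0 = 1"
  using of_nat_card_PF by (simp add: psum_def)

definition trinom :: "'k \<Rightarrow> 'k poly" where
  "trinom c = Polynomial.monom 1 (Suc q) - Polynomial.monom (1 + c) 1 + [:c:]"

lemma degree_trinom: "Polynomial.degree (trinom c) = Suc q"
  and lead_coeff_trinom: "lead_coeff (trinom c) = 1"
proof -
  have c: "Polynomial.coeff (trinom c) (Suc q) = 1"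
    using q_ge_2 by (simp add: trinom_def coeff_pCons split: nat.splits)
  moreover have "Polynomial.degree (trinom c) \<le> Suc q"
    by (rule degree_le) (use q_ge_2 in \<open>auto simp: trinom_def coeff_pCons split: nat.splits\<close>)
  ultimately show d: "Polynomial.degree (trinom c) = Suc q"
    by (metis le_antisym le_degree zero_neq_one)
  show "lead_coeff (trinom c) = 1" using c d by simp
qed

text \<open>Both sides are monic of degree q + 1, so their difference has degree at most q, yet it
  vanishes at the q + 1 distinct values of \<open>conj_quot \<alpha>\<close>.\<close>

lemma trinom_eq_prod:
  assumes "\<alpha> \<notin> F"
  shows "trinom (kappa \<alpha>) = (\<Prod>x\<in>PF. [:- conj_quot \<alpha> x, 1:])"
proof -
  define P where "P = (\<Prod>x\<in>PF. [:- conj_quot \<alpha> x, 1:])"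
  define D where "D = trinom (kappa \<alpha>) - P"
  have dP: "Polynomial.degree P = Suc q" 
    unfolding P_def using card_PF by (subst degree_prod_eq_sum_degree) auto
  have lP: "lead_coeff P = 1"
    unfolding P_def by (simp add: lead_coeff_prod)
  have deg: "Polynomial.degree D < Suc q \<or> D = 0"
    using degree_diff_le[of "trinom (kappa \<alpha>)" "Suc q" P] dP lP 
      degree_trinom[of "kappa \<alpha>"] lead_coeff_trinom[of "kappa \<alpha>"] eq_zero_or_degree_less[of D "Suc q"]
    unfolding D_def by auto
  have root: "poly D (conj_quot \<alpha> x) = 0" if "x \<in> PF" for x
    using conj_quot_root[OF assms that] that finite_PF
    by (auto simp: D_def P_def trinom_def poly_monom poly_prod algebra_simps)
  have "D = 0"
  proof (rule ccontr)
    assume "D \<noteq> 0"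
    then have "card {y. poly D y = 0} \<le> Polynomial.degree D" 
      by (rule card_poly_roots_bound)
    moreover have "card (conj_quot \<alpha> ` PF) \<le> card {y. poly D y = 0}"
      using root by (intro card_mono poly_roots_finite \<open>D \<noteq> 0\<close>) auto
    moreover have "card (conj_quot \<alpha> ` PF) = Suc q"
      using conj_quot_inj[OF assms] by (simp add: card_image card_PF)
    ultimately show False using deg \<open>D \<noteq> 0\<close> by simp
  qed
  then show ?thesis by (simp add: D_def P_def)
qed

text \<open>Newton's identities in terms of the derivative: \<open>pderiv\<close> of the trinomial
  is the sum of its quotients by the factors \<open>X - y\<close>, and the coefficients of that sum
  are power sums. As q is zero in the field, the derivative has terms in degrees q and 0 only, and
  the constant terms of the two sides cancel.\<close>

lemma psum_eq_0:
  assumes "\<alpha> \<notin> F" "1 \<le> k" "k \<le> q"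
  shows "psum \<alpha> k = 0"
proof -
  let ?c = "kappa \<alpha>" and ?y = "conj_quot \<alpha>"
  define R where "R = (\<Sum>m\<le>q. Polynomial.monom (psum \<alpha> (q - m)) m) - [:1 + ?c:]"
  have geo: "(Polynomial.monom 1 (Suc q) - Polynomial.monom (y ^ Suc q) 0 :: 'k poly) =
      [:- y, 1:] * (\<Sum>m\<le>q. Polynomial.monom (y ^ (q - m)) m)" for y
  proof (rule Polynomial.poly_eqI)
    fix n
    have "Polynomial.coeff (\<Sum>m\<le>q. Polynomial.monom (y ^ (q - m)) m) n =
      (if n \<le> q then y ^ (q - n) else 0)" for n
      by (simp add: coeff_sum)
    then show "Polynomial.coeff (Polynomial.monom 1 (Suc q) - Polynomial.monom (y ^ Suc q) 0 :: 'k poly) n =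
      Polynomial.coeff ([:- y, 1:] * (\<Sum>m\<le>q. Polynomial.monom (y ^ (q - m)) m)) n"
      by (cases n) (auto simp: Suc_diff_le not_less_eq_eq le_Suc_eq Suc_diff_Suc
          simp flip: power_Suc)
  qed
  \<comment> \<open>Exact division by \<open>X - y\<close>: since y is a root, the trinomial is
    \<open>X ^ Suc q - y ^ Suc q\<close> minus \<open>(1 + ?c) * (X - y)\<close>.\<close>
  have rest: "(\<Prod>z\<in>PF - {x}. [:- ?y z, 1:]) =
      (\<Sum>m\<le>q. Polynomial.monom (?y x ^ (q - m)) m) - [:1 + ?c:]" if "x \<in> PF" for x
  proof -
    have "[:- ?y x, 1:] * (\<Prod>z\<in>PF - {x}. [:- ?y z, 1:]) = trinom ?c"
      using that finite_PF by (simp add: trinom_eq_prod[OF assms(1)] prod.remove)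
    also have "\<dots> = Polynomial.monom 1 (Suc q) - Polynomial.monom (?y x ^ Suc q) 0
        - Polynomial.smult (1 + ?c) [:- ?y x, 1:]"
      using conj_quot_root[OF assms(1) that]
      by (simp add: trinom_def monom_0 monom_Suc algebra_simps)
    also have "\<dots> = [:- ?y x, 1:] * ((\<Sum>m\<le>q. Polynomial.monom (?y x ^ (q - m)) m) - [:1 + ?c:])"
      unfolding geo by (simp add: algebra_simps)
    finally show ?thesis
      by (subst (asm) mult_cancel_left) simp
  qed
  have "pderiv (trinom ?c) = (\<Sum>x\<in>PF. \<Prod>z\<in>PF - {x}. [:- ?y z, 1:])"
    unfolding trinom_eq_prod[OF assms(1)] pderiv_prod by (simp add: pderiv_pCons)
  also have "\<dots> = (\<Sum>x\<in>PF. (\<Sum>m\<le>q. Polynomial.monom (?y x ^ (q - m)) m) - [:1 + ?c:])"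
    by (rule sum.cong) (auto simp: rest)
  also have "\<dots> = (\<Sum>m\<le>q. Polynomial.monom (psum \<alpha> (q - m)) m) - Polynomial.smult (of_nat (card PF)) [:1 + ?c:]"
  proof -
    have "(\<Sum>x\<in>PF. \<Sum>m\<le>q. Polynomial.monom (?y x ^ (q - m)) m) =
        (\<Sum>m\<le>q. Polynomial.monom (psum \<alpha> (q - m)) m)"
      by (subst sum.swap) (simp add: psum_def monom_sum)
    then show ?thesis
      by (simp add: sum_subtractf of_nat_poly)
  qed
  finally have eq: "pderiv (trinom ?c) = R"
    by (simp add: R_def of_nat_card_PF)
  have "Polynomial.coeff (pderiv (trinom ?c)) (q - k) = Polynomial.coeff R (q - k)" 
    by (simp only: eq)
  then show ?thesis
    using assms of_nat_q
    by (auto simp: R_def coeff_sum coeff_pderiv trinom_def coeff_pCons split: nat.splits if_splits)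
qed

text \<open>Sum the trinomial relation over \<open>PF\<close>: the first power sum vanishes, and the
  q + 1 points count as 1 in the field.\<close>

lemma psum_Suc_q:
  assumes "\<alpha> \<notin> F"
  shows "psum \<alpha> (Suc q) = - kappa \<alpha>"
proof -
  have "psum \<alpha> (Suc q) = (\<Sum>x\<in>PF. (1 + kappa \<alpha>) * conj_quot \<alpha> x - kappa \<alpha>)"
    unfolding psum_def using conj_quot_root[OF assms] by (intro sum.cong) (auto simp: algebra_simps)
  also have "\<dots> = (1 + kappa \<alpha>) * psum \<alpha> 1 - kappa \<alpha> * of_nat (card PF)"
    by (simp add: psum_def sum_subtractf sum_distrib_left)
  also have "\<dots> = - kappa \<alpha>"
    using psum_eq_0[OF assms, of 1] q_ge_2 by (simp add: of_nat_card_PF)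
  finally show ?thesis .
qed

section \<open>Mixed sums for two such functions\<close>

definition mixed_sum :: "'k \<Rightarrow> 'k \<Rightarrow> nat \<Rightarrow> 'k" where
  "mixed_sum \<alpha> \<beta> s = (\<Sum>x\<in>PF. conj_quot \<alpha> x ^ s * conj_quot \<beta> x)"

text \<open>Write \<open>\<tau>\<close> for the value of \<open>conj_quot \<alpha>\<close> at \<open>\<beta>\<close>. The factor \<open>conj_quot \<alpha> - \<tau>\<close> cancels the
  pole of \<open>conj_quot \<beta>\<close>, so \<open>(conj_quot \<alpha> - \<tau>) * conj_quot \<beta>\<close> is affine in \<open>conj_quot \<alpha>\<close>.\<close>

lemma mixed_sum_Suc:
  assumes "\<alpha> \<notin> F" "\<beta> \<notin> F" "\<alpha> \<noteq> \<beta>"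
  shows "mixed_sum \<alpha> \<beta> (Suc s) = (\<beta> - \<alpha> ^ q) / (\<beta> - \<alpha>) * mixed_sum \<alpha> \<beta> s
     - ((\<beta> ^ q - \<alpha> ^ q) * psum \<alpha> s + (\<alpha> - \<beta> ^ q) * psum \<alpha> (Suc s)) / (\<beta> - \<alpha>)"
proof -
  have pt: "conj_quot \<alpha> x ^ Suc s * conj_quot \<beta> x =
      (\<beta> - \<alpha> ^ q) / (\<beta> - \<alpha>) * (conj_quot \<alpha> x ^ s * conj_quot \<beta> x)
      - ((\<beta> ^ q - \<alpha> ^ q) * conj_quot \<alpha> x ^ s + (\<alpha> - \<beta> ^ q) * conj_quot \<alpha> x ^ Suc s) / (\<beta> - \<alpha>)"
    if "x \<in> PF" for x
  proof -
    have ab: "\<beta> - \<alpha> \<noteq> 0" using assms by simp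
    have "conj_quot \<alpha> x * conj_quot \<beta> x = (\<beta> - \<alpha> ^ q) / (\<beta> - \<alpha>) * conj_quot \<beta> x
      - ((\<beta> ^ q - \<alpha> ^ q) + (\<alpha> - \<beta> ^ q) * conj_quot \<alpha> x) / (\<beta> - \<alpha>)"
    proof (cases x)
      case Infty
      then show ?thesis using ab by (simp add: divide_simps)
    next
      case (Aff z)
      then have "z \<in> F" using that by (auto simp: PF_def)
      then have "z - \<alpha> \<noteq> 0" "z - \<beta> \<noteq> 0" using assms by auto
      then show ?thesis using ab unfolding Aff by (simp add: divide_simps) (simp add: algebra_simps)
    qed
    then have "conj_quot \<alpha> x ^ s * (conj_quot \<alpha> x * conj_quot \<beta> x) = conj_quot \<alpha> x ^ s *
      ((\<beta> - \<alpha> ^ q) / (\<beta> - \<alpha>) * conj_quot \<beta> x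
        - ((\<beta> ^ q - \<alpha> ^ q) + (\<alpha> - \<beta> ^ q) * conj_quot \<alpha> x) / (\<beta> - \<alpha>))"
      by (rule arg_cong)
    then show ?thesis
      by (simp add: algebra_simps add_divide_distrib diff_divide_distrib)
  qed
  show ?thesis
    unfolding mixed_sum_def psum_def
    by (subst sum.cong[OF refl pt])
      (simp_all only: sum_subtractf sum.distrib sum_distrib_left add_divide_distrib sum_divide_distrib)
qed

lemma mixed_sum_0:
  assumes "\<beta> \<notin> F"
  shows "mixed_sum \<alpha> \<beta> 0 = 0"
  using psum_eq_0[OF assms, of 1] q_ge_2 by (simp add: mixed_sum_def psum_def)

text \<open>In this range of exponents only \<open>psum \<alpha> 0 = 1\<close> contributes to the
  recursion, so from exponent 1 on the mixed sums form a geometric progression with ratio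
  \<tau>.\<close>

lemma mixed_sum_eq:
  assumes "\<alpha> \<notin> F" "\<beta> \<notin> F" "\<alpha> \<noteq> \<beta>" "Suc s \<le> q"
  shows "mixed_sum \<alpha> \<beta> (Suc s) =
    ((\<beta> - \<alpha> ^ q) / (\<beta> - \<alpha>)) ^ s * ((\<alpha> ^ q - \<beta> ^ q) / (\<beta> - \<alpha>))"
  using assms(4)
proof (induction s)
  case 0
  then show ?case
    using assms(1-3) psum_eq_0[OF assms(1), of 1]
    by (simp add: mixed_sum_Suc mixed_sum_0 psum_0 divide_simps)
next
  case (Suc s)
  then show ?case
    using psum_eq_0[OF assms(1), of "Suc s"] psum_eq_0[OF assms(1), of "Suc (Suc s)"]
    by (simp add: mixed_sum_Suc[OF assms(1-3)])
qed

text \<open>For s at most q all factors of the closed form are nonzero. The exponent q + 1 brings in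
  \<open>psum \<alpha> (Suc q)\<close>; it occurs later for q = 2 and exponent 3.\<close>

lemma mixed_sum_nonzero:
  assumes "\<alpha> \<notin> F" "\<beta> \<notin> F" "\<alpha> \<noteq> \<beta>" "\<beta> \<noteq> \<alpha> ^ q" "1 \<le> s"
    and "s \<le> q \<or> s = Suc q \<and> \<alpha> ^ (q ^ 2) \<noteq> \<alpha>"
  shows "mixed_sum \<alpha> \<beta> s \<noteq> 0"
proof -
  have ab: "\<alpha> ^ q \<noteq> \<beta> ^ q" using assms(3) by (simp add: frob_inj)
  consider "s \<le> q" | "s = Suc q" "\<alpha> ^ (q ^ 2) \<noteq> \<alpha>" using assms(6) by auto
  then show ?thesis
  proof cases
    case 1
    obtain r where "s = Suc r" using assms(5) by (cases s) auto
    then show ?thesis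
      using assms 1 ab by (simp add: mixed_sum_eq)
  next
    case 2
    define a b c where "a = \<alpha> ^ q" and "b = \<beta> ^ q" and "c = \<alpha> ^ (q ^ 2)"
    define \<tau> where "\<tau> = (\<beta> - a) / (\<beta> - \<alpha>)"
    obtain r where r: "q = Suc r" using q_ge_2 by (cases q) auto
    have ne: "\<beta> - \<alpha> \<noteq> 0" "b - a \<noteq> 0" "\<alpha> - a \<noteq> 0"
      using assms ab by (auto simp: a_def b_def in_F_iff)
    have tq: "\<tau> ^ q = (b - c) / (b - a)"
      by (simp add: \<tau>_def power_divide frob_diff a_def b_def c_def frob_frob)
    have "mixed_sum \<alpha> \<beta> q = \<tau> ^ r * ((a - b) / (\<beta> - \<alpha>))"
      using mixed_sum_eq[OF assms(1-3), of r] by (simp add: r \<tau>_def a_def b_def)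
    \<comment> \<open>The additional factor completes the power to \<open>\<tau> ^ q\<close>, which
      Frobenius evaluates. This product is the first term of the recursion.\<close>
    then have "\<tau> * mixed_sum \<alpha> \<beta> q = \<tau> ^ q * ((a - b) / (\<beta> - \<alpha>))"
      by (simp add: r)
    also have "\<dots> = - (b - c) / (\<beta> - \<alpha>)"
      unfolding tq using ne by (simp add: divide_simps) (simp add: algebra_simps)
    finally have 1: "\<tau> * mixed_sum \<alpha> \<beta> q = - (b - c) / (\<beta> - \<alpha>)" .
    have "mixed_sum \<alpha> \<beta> s = - (b - c) / (\<beta> - \<alpha>) + (\<alpha> - b) * kappa \<alpha> / (\<beta> - \<alpha>)"
      using mixed_sum_Suc[OF assms(1-3), of q] psum_eq_0[OF assms(1), of q] q_ge_2 1
        psum_Suc_q[OF assms(1)]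
      by (simp add: 2 \<tau>_def a_def b_def)
    also have "\<dots> = (\<alpha> - c) * (a - b) / ((\<beta> - \<alpha>) * (\<alpha> - a))"
      unfolding kappa_def a_def[symmetric] c_def[symmetric] using ne
      by (simp add: divide_simps) (simp add: algebra_simps)
    also have "\<dots> \<noteq> 0"
      using ne 2 by (auto simp: c_def)
    finally show ?thesis .
  qed
qed

end


section \<open>A Mason--Stothers bound\<close>

definition two_point_poly :: "nat \<Rightarrow> nat \<Rightarrow> 'k::field \<Rightarrow> 'k \<Rightarrow> 'k poly" where
  "two_point_poly s t \<alpha> \<beta> = [:- \<alpha>, 1:] ^ s * [:- \<beta>, 1:] ^ t"

definition wronskian :: "'k::field poly \<Rightarrow> 'k poly \<Rightarrow> 'k poly" where
  "wronskian f g = f * pderiv g - pderiv f * g"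

text \<open>Subtracting f from g does not change the Wronskian but cancels the leading term of g,
  which gains one degree over the bound 2n - 1 for the products.\<close>

lemma degree_wronskian:
  fixes f g :: "'k::field poly"
  assumes "lead_coeff f = 1" "lead_coeff g = 1" "Polynomial.degree f = n" "Polynomial.degree g = n"
  shows "Polynomial.degree (wronskian f g) \<le> 2 * n - 2"
proof -
  have eq: "wronskian f g = f * pderiv (g - f) - pderiv f * (g - f)"
    by (simp add: wronskian_def pderiv_diff algebra_simps)
  show ?thesis
  proof (cases "g = f")
    case True
    then show ?thesis by (simp add: wronskian_def mult.commute)
  next
    case False
    have d: "Polynomial.degree (g - f) < n"
    proof -
      have "Polynomial.degree (g - f) \<le> n" using assms by (simp add: degree_diff_le)
      moreover have "Polynomial.coeff (g - f) n = 0" using assms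
        by (metis Polynomial.coeff_diff diff_self)
      ultimately show ?thesis using False
        by (metis eq_iff_diff_eq_0 leading_coeff_neq_0 order_le_less)
    qed
    have pd: "Polynomial.degree (pderiv p) \<le> Polynomial.degree p - 1" for p :: "'k poly"
      by (rule degree_le) (auto simp: coeff_pderiv coeff_eq_0)
    have "Polynomial.degree (pderiv f * (g - f)) \<le> (n - 1) + (n - 1)"
      using pd[of f] d assms(3)
      by (intro order.trans[OF degree_mult_le]) linarith
    moreover have "Polynomial.degree (f * pderiv (g - f)) \<le> 2 * n - 2"
    proof (cases "pderiv (g - f) = 0")
      case False
      then have "Polynomial.degree (g - f) \<noteq> 0"
        by (metis degree_eq_zeroE pderiv_singleton)
      then show ?thesis 
        using pd[of "g - f"] d assms(3)
        by (intro order.trans[OF degree_mult_le]) linarith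
    qed simp
    ultimately show ?thesis
      unfolding eq by (intro degree_diff_le) auto
  qed
qed

text \<open>Differentiation costs \<open>l ^ s\<close> one factor, except when s is zero in the
  field: then its derivative vanishes and no factor is lost.\<close>

lemma power_dvd_wronskian:
  assumes "l ^ s dvd f"
  shows "l ^ (if of_nat s = (0 :: 'k) then s else s - 1) dvd wronskian f (g :: 'k::field poly)"
proof -
  define m where "m = (if of_nat s = (0 :: 'k) then s else s - 1)"
  have ms: "m \<le> s" by (simp add: m_def)
  obtain r where r: "f = l ^ s * r" using assms by (auto simp: dvd_def)
  have 1: "l ^ m dvd l ^ s" by (rule le_imp_power_dvd[OF ms])
  have "l ^ m dvd pderiv (l ^ s)"
    by (cases s) (auto simp: m_def pderiv_power_Suc dvd_smult simp del: of_nat_Suc power_Suc)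
  then have "l ^ m dvd pderiv f"
    using 1 by (simp add: r pderiv_mult dvd_mult2)
  then show ?thesis using 1
    unfolding m_def[symmetric] wronskian_def r by (simp add: dvd_diff dvd_mult2)
qed

lemma two_point_poly_dvd_iff:
  fixes p :: "'k::field poly"
  assumes "\<alpha> \<noteq> \<beta>" "p \<noteq> 0"
  shows "two_point_poly s t \<alpha> \<beta> dvd p \<longleftrightarrow> s \<le> Polynomial.order \<alpha> p \<and> t \<le> Polynomial.order \<beta> p"
proof
  assume "two_point_poly s t \<alpha> \<beta> dvd p"
  then have "[:- \<alpha>, 1:] ^ s dvd p" "[:- \<beta>, 1:] ^ t dvd p"
    unfolding two_point_poly_def by (blast dest: dvd_mult_left dvd_mult_right)+
  then show "s \<le> Polynomial.order \<alpha> p \<and> t \<le> Polynomial.order \<beta> p"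
    using assms by (simp add: order_divides)
next
  assume st: "s \<le> Polynomial.order \<alpha> p \<and> t \<le> Polynomial.order \<beta> p"
  then have "[:- \<alpha>, 1:] ^ s dvd p" using assms by (simp add: order_divides)
  then obtain r where r: "p = [:- \<alpha>, 1:] ^ s * r" by (rule dvdE)
  have "r \<noteq> 0" using r assms by auto
  then have "Polynomial.order \<beta> p = Polynomial.order \<beta> r"
    using assms unfolding r by (subst order_mult) (auto simp: order_0I)
  with st \<open>r \<noteq> 0\<close> have "[:- \<beta>, 1:] ^ t dvd r" by (simp add: order_divides)
  then show "two_point_poly s t \<alpha> \<beta> dvd p" by (simp add: r two_point_poly_def mult_dvd_mono)
qed

lemma two_point_poly_wronskian_dvd:
  fixes \<alpha> \<beta> :: "'k::field"
  assumes "\<alpha> \<noteq> \<beta>"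
  defines "e \<equiv> \<lambda>s. if of_nat s = (0 :: 'k) then s else s - 1"
  shows "two_point_poly (e s) (e t) \<alpha> \<beta> dvd wronskian (two_point_poly s t \<alpha> \<beta>) g"
proof (cases "wronskian (two_point_poly s t \<alpha> \<beta>) g = 0")
  case False
  have "[:- \<alpha>, 1:] ^ e s dvd wronskian (two_point_poly s t \<alpha> \<beta>) g"
    "[:- \<beta>, 1:] ^ e t dvd wronskian (two_point_poly s t \<alpha> \<beta>) g"
    unfolding e_def by (rule power_dvd_wronskian, simp add: two_point_poly_def)+
  then show ?thesis
    using False assms(1) by (simp add: two_point_poly_dvd_iff order_divides)
qed simp

lemma lead_coeff_two_point_poly: "lead_coeff (two_point_poly s t \<alpha> (\<beta> :: 'k::field)) = 1"
  by (simp add: two_point_poly_def lead_coeff_mult lead_coeff_power)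

lemma degree_two_point_poly: "Polynomial.degree (two_point_poly s t \<alpha> (\<beta> :: 'k::field)) = s + t"
  by (simp add: two_point_poly_def degree_mult_eq degree_power_eq)

lemma poly_two_point_poly: "poly (two_point_poly s t \<alpha> \<beta>) x = (x - \<alpha>) ^ s * (x - \<beta>) ^ t"
  by (simp add: two_point_poly_def)

text \<open>Up to powers of the two linear factors the derivative is
  \<open>s (X - \<beta>) + t (X - \<alpha>)\<close>; this is evaluated at \<alpha> and at
  \<beta>.\<close>

lemma pderiv_two_point_poly_zero:
  fixes \<alpha> \<beta> :: "'k::field"
  assumes "\<alpha> \<noteq> \<beta>" "s > 0" "t > 0" "pderiv (two_point_poly s t \<alpha> \<beta>) = 0"
  shows "of_nat s = (0 :: 'k)" "of_nat t = (0 :: 'k)"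
proof -
  obtain s' t' where st: "s = Suc s'" "t = Suc t'" using assms by (cases s; cases t) auto
  have "pderiv (two_point_poly s t \<alpha> \<beta>) = [:- \<alpha>, 1:] ^ s' * [:- \<beta>, 1:] ^ t' *
      (Polynomial.smult (of_nat s) [:- \<beta>, 1:] + Polynomial.smult (of_nat t) [:- \<alpha>, 1:])"
  proof -
    define l m where "l = [:- \<alpha>, 1:]" and "m = [:- \<beta>, 1:]"
    have "pderiv l = 1" "pderiv m = 1"
      by (simp_all add: l_def m_def pderiv_pCons)
    then show ?thesis
      unfolding two_point_poly_def st pderiv_mult pderiv_power_Suc
        l_def[symmetric] m_def[symmetric]
      by (simp add: algebra_simps del: of_nat_Suc)
  qed
  then have "Polynomial.smult (of_nat s) [:- \<beta>, 1:] + Polynomial.smult (of_nat t) [:- \<alpha>, 1:] = 0"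
    using assms(4) by (metis mult_eq_0_iff pCons_eq_0_iff power_not_zero zero_neq_one)
  then have "poly (Polynomial.smult (of_nat s) [:- \<beta>, 1:] + Polynomial.smult (of_nat t) [:- \<alpha>, 1:]) x = 0" for x
    by simp
  then have 0: "of_nat s * (x - \<beta>) + of_nat t * (x - \<alpha>) = 0" for x
    by (simp only: poly_add poly_smult poly_pCons poly_0 mult_1_right mult_zero_right add_0_right uminus_add_conv_diff)
  show "of_nat s = (0 :: 'k)" using 0[of \<alpha>] assms(1) by simp
  show "of_nat t = (0 :: 'k)" using 0[of \<beta>] assms(1) by simp
qed

text \<open>The linear relation makes the three pairwise Wronskians agree up to nonzero constants,
  so a single W is divisible by high powers of all six linear factors. Comparison with the degree of
  W gives 3(s + t - 2) \<le> 2(s + t) - 2 if s and t are nonzero in the field. If exactly one of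
  them is zero there, it gives s + t \<le> 1, which is absurd.\<close>

theorem mason_two_point:
  fixes \<alpha> \<beta> :: "nat \<Rightarrow> 'k::field" and c :: "nat \<Rightarrow> 'k"
  assumes inj: "inj_on \<alpha> {..<3}" "inj_on \<beta> {..<3}" "\<And>i j. i < 3 \<Longrightarrow> j < 3 \<Longrightarrow> \<alpha> i \<noteq> \<beta> j"
    and st: "s > 0" "t > 0" "\<not> (of_nat s = (0 :: 'k) \<and> of_nat t = (0 :: 'k))"
    and c: "\<And>i. i < 3 \<Longrightarrow> c i \<noteq> 0"
    and rel: "(\<Sum>i<3. Polynomial.smult (c i) (two_point_poly s t (\<alpha> i) (\<beta> i))) = 0"
  shows "of_nat s \<noteq> (0 :: 'k)" "of_nat t \<noteq> (0 :: 'k)" "s + t \<le> 4"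
proof -
  define e where "e = (\<lambda>s. if of_nat s = (0 :: 'k) then s else s - 1)"
  define f where "f = (\<lambda>i. two_point_poly s t (\<alpha> i) (\<beta> i))"
  define W where "W = wronskian (f 0) (f 1)"
  have rel': "Polynomial.smult (c 0) (f 0) + Polynomial.smult (c 1) (f 1) + Polynomial.smult (c 2) (f 2) = 0"
    using rel by (simp add: f_def eval_nat_numeral)
  have W2: "Polynomial.smult (c 2) (wronskian (f 2) (f 0)) = Polynomial.smult (c 1) W"
  proof -
    have "Polynomial.smult (c 2) (f 2) =
      - Polynomial.smult (c 0) (f 0) - Polynomial.smult (c 1) (f 1)"
      using rel' by (simp add: algebra_simps add_eq_0_iff)
    then have "wronskian (Polynomial.smult (c 2) (f 2)) (f 0) =
      wronskian (- Polynomial.smult (c 0) (f 0) - Polynomial.smult (c 1) (f 1)) (f 0)" by simp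
    then show ?thesis
      by (simp add: wronskian_def W_def pderiv_smult pderiv_diff pderiv_minus algebra_simps smult_diff_right)
  qed
  have W1: "wronskian (f 1) (f 0) = - W"
    by (simp add: W_def wronskian_def algebra_simps)
  have dvd: "two_point_poly (e s) (e t) (\<alpha> i) (\<beta> i) dvd W" if "i < 3" for i
  proof -
    have d: "two_point_poly (e s) (e t) (\<alpha> i) (\<beta> i) dvd wronskian (f i) g" for g
      unfolding e_def f_def by (rule two_point_poly_wronskian_dvd) (use inj(3) that in auto)
    consider "i = 0" | "i = 1" | "i = 2" using \<open>i < 3\<close> by linarith
    then show ?thesis
    proof cases
      case 1 then show ?thesis using d[of "f 1"] by (simp add: W_def)
    next
      case 2 then show ?thesis using d[of "f 0"] W1 by simp
    next
      case 3
      then have "two_point_poly (e s) (e t) (\<alpha> i) (\<beta> i) dvd Polynomial.smult (c 1) W"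
        using d[of "f 0"] dvd_smult W2 by metis
      then show ?thesis using c[of 1] by (simp add: dvd_smult_iff)
    qed
  qed
  \<comment> \<open>If W vanished, \<open>f 0\<close> would divide its own derivative, because it
    has no root in common with \<open>f 1\<close>. By degrees that derivative is zero, so s and t
    are both zero in the field.\<close>
  have W0: "W \<noteq> 0"
  proof
    assume "W = 0"
    then have "f 0 dvd pderiv (f 0) * f 1"
      by (intro dvdI[of _ _ "pderiv (f 1)"]) (simp add: W_def wronskian_def)
    moreover have "poly (f 1) (\<alpha> 0) \<noteq> 0" "poly (f 1) (\<beta> 0) \<noteq> 0"
      using inj_onD[OF inj(1), of 0 1] inj_onD[OF inj(2), of 0 1] inj(3)[of 0 1] inj(3)[of 1 0]
      by (auto simp: f_def poly_two_point_poly)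
    moreover have "f 1 \<noteq> 0"
      using calculation(2) by auto
    ultimately have "f 0 dvd pderiv (f 0)"
      using inj(3)[of 0 0] unfolding f_def
      by (cases "pderiv (two_point_poly s t (\<alpha> 0) (\<beta> 0)) = 0")
        (simp_all add: two_point_poly_dvd_iff order_mult order_0I)
    moreover have "Polynomial.degree (f 0) > 0"
      using st by (simp add: f_def degree_two_point_poly)
    moreover have "Polynomial.degree (pderiv (f 0)) \<le> Polynomial.degree (f 0) - 1"
      by (rule degree_le) (auto simp: coeff_pderiv coeff_eq_0)
    ultimately have "pderiv (f 0) = 0"
      by (metis diff_less dvd_imp_degree_le leD le_trans zero_less_one)
    then show False
      using pderiv_two_point_poly_zero[of "\<alpha> 0" "\<beta> 0" s t] st inj(3)[of 0 0] by (auto simp: f_def)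
  qed
  have ord: "e s \<le> Polynomial.order (\<alpha> i) W" "e t \<le> Polynomial.order (\<beta> i) W" if "i < 3" for i
    using dvd[OF that] W0 inj(3)[OF that that] by (simp_all add: two_point_poly_dvd_iff)
  define R where "R = \<alpha> ` {..<3} \<union> \<beta> ` {..<3}"
  have "(\<Sum>x\<in>R. Polynomial.order x W) \<le> Polynomial.degree W"
  proof -
    have "(\<Sum>x\<in>R. Polynomial.order x W) = (\<Sum>x\<in>R \<inter> {x. poly W x = 0}. Polynomial.order x W)"
      by (rule sum.mono_neutral_right) (auto simp: R_def order_root W0)
    also have "\<dots> \<le> (\<Sum>x | poly W x = 0. Polynomial.order x W)"
      by (rule sum_mono2) (use W0 poly_roots_finite in auto)
    also have "\<dots> \<le> Polynomial.degree W"
      by (rule sum_order_le_degree[OF W0])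
    finally show ?thesis .
  qed
  moreover have "(\<Sum>x\<in>R. Polynomial.order x W) =
    (\<Sum>i<3. Polynomial.order (\<alpha> i) W) + (\<Sum>i<3. Polynomial.order (\<beta> i) W)"
    unfolding R_def using inj by (subst sum.union_disjoint) (auto simp: sum.reindex)
  moreover have "(\<Sum>i<3. Polynomial.order (\<alpha> i) W) \<ge> 3 * e s"
    "(\<Sum>i<3. Polynomial.order (\<beta> i) W) \<ge> 3 * e t"
    using sum_mono[of "{..<3}" "\<lambda>i. e s"  "\<lambda>i. Polynomial.order (\<alpha> i) W"]
      sum_mono[of "{..<3}" "\<lambda>i. e t"  "\<lambda>i. Polynomial.order (\<beta> i) W"] ord by auto
  moreover have "Polynomial.degree W \<le> 2 * (s + t) - 2"
    using lead_coeff_two_point_poly[of s t] unfolding W_def f_def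
    by (intro degree_wronskian) (simp_all only: degree_two_point_poly)
  ultimately have *: "3 * e s + 3 * e t \<le> 2 * (s + t) - 2" by linarith
  show "of_nat s \<noteq> (0 :: 'k)" "of_nat t \<noteq> (0 :: 'k)" "s + t \<le> 4"
    using * st by (auto simp: e_def split: if_splits)
qed


section \<open>Fibres with two points\<close>

text \<open>This serves both for the q-th power map and for \<open>to_ac\<close>.\<close>

lemma map_poly_ring_hom:
  fixes f :: "'a::comm_ring_1 \<Rightarrow> 'b::comm_ring_1"
  assumes "f 0 = 0" "\<And>x y. f (x + y) = f x + f y" "\<And>x y. f (x * y) = f x * f y"
  shows "map_poly f (p + r) = map_poly f p + map_poly f r"
    and "map_poly f (p * r) = map_poly f p * map_poly f r"
    and "map_poly f (Polynomial.smult c p) = Polynomial.smult (f c) (map_poly f p)"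
proof -
  have sum: "f (\<Sum>i\<in>A. g i) = (\<Sum>i\<in>A. f (g i))" for g and A :: "nat set"
    by (induction A rule: infinite_finite_induct) (simp_all add: assms)
  show "map_poly f (p + r) = map_poly f p + map_poly f r"
    "map_poly f (p * r) = map_poly f p * map_poly f r"
    "map_poly f (Polynomial.smult c p) = Polynomial.smult (f c) (map_poly f p)"
    by (rule Polynomial.poly_eqI; simp add: coeff_map_poly assms coeff_mult sum)+
qed

lemma two_point_poly_scale:
  "two_point_poly (n * s) (n * t) \<alpha> \<beta> = two_point_poly s t \<alpha> \<beta> ^ n"
  by (simp add: two_point_poly_def power_mult_distrib mult.commute[of n] flip: power_mult)

lemma two_point_poly_commute: "two_point_poly s t \<alpha> \<beta> = two_point_poly t s \<beta> \<alpha>"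
  by (simp add: two_point_poly_def mult.commute)

text \<open>Here a / b is h over the algebraic closure and \<open>\<Phi>\<close> is its action on
  the rational points. The identity \<open>\<Phi>_conj_quot\<close> comes from dividing the q-th
  power of \<open>fibre\<close> at a rational point by \<open>fibre\<close> itself, with
  \<open>c ^ q / c\<close> in the role of C.\<close>

locale two_point_fibre = frobenius_field q F
  for q :: nat and F :: "'k::alg_closed_field set" +
  fixes m s t :: nat and a b :: "'k poly" and \<Phi> :: "'k proj_line \<Rightarrow> 'k proj_line"
    and \<alpha> \<beta> \<gamma> c C :: 'k
  assumes q_power: "q = CHAR('k) ^ m" and prime_CHAR: "Factorial_Ring.prime CHAR('k)"
    and a_fixed: "map_poly (\<lambda>x. x ^ q) a = a" and b_fixed: "map_poly (\<lambda>x. x ^ q) b = b"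
    and no_common_root: "\<And>x. \<not> (poly a x = 0 \<and> poly b x = 0)"
    and fibre: "a - Polynomial.smult \<gamma> b = Polynomial.smult c (two_point_poly s t \<alpha> \<beta>)"
    and c_nonzero: "c \<noteq> 0" and s_pos: "s > 0" and t_pos: "t > 0" and gcd_t: "gcd t (q + 1) = 1"
    and \<gamma>_notin: "\<gamma> \<notin> F" and \<alpha>_neq_\<beta>: "\<alpha> \<noteq> \<beta>"
    and \<Phi>_PF: "\<Phi> \<in> PF \<rightarrow> PF" and C_nonzero: "C \<noteq> 0"
    and \<Phi>_conj_quot: "\<And>x. x \<in> PF \<Longrightarrow> conj_quot \<gamma> (\<Phi> x) = C * conj_quot \<alpha> x ^ s * conj_quot \<beta> x ^ t"
begin

text \<open>Frobenius acts on the coefficients and fixes a and b. Iteration yields the fibres over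
  the conjugates of \<gamma>, with the same multiplicities.\<close>

lemma frob_poly_fibre:
  assumes "a - Polynomial.smult \<gamma>' b = Polynomial.smult c' (two_point_poly s t \<alpha>' \<beta>')"
  shows "a - Polynomial.smult (\<gamma>' ^ q) b =
    Polynomial.smult (c' ^ q) (two_point_poly s t (\<alpha>' ^ q) (\<beta>' ^ q))"
proof -
  let ?f = "\<lambda>x :: 'k. x ^ q"
  note hom = map_poly_ring_hom[of ?f, OF frob_zero frob_add power_mult_distrib]
  have pow: "map_poly ?f (p ^ n) = map_poly ?f p ^ n" for p n
    by (induction n) (simp_all add: hom)
  have "map_poly ?f (a - Polynomial.smult \<gamma>' b) = map_poly ?f (a + Polynomial.smult (- \<gamma>') b)"
    by simp
  also have "\<dots> = a - Polynomial.smult (\<gamma>' ^ q) b"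
    by (simp only: hom a_fixed b_fixed frob_minus) simp
  finally show ?thesis
    unfolding assms two_point_poly_def by (simp add: hom pow map_poly_pCons frob_minus)
qed

lemmas fibre1 = frob_poly_fibre[OF fibre]
lemmas fibre2 = frob_poly_fibre[OF fibre1, unfolded frob_frob]

lemma root_iff:
  assumes "a - Polynomial.smult \<gamma>' b = Polynomial.smult c' (two_point_poly s t \<alpha>' \<beta>')" "c' \<noteq> 0"
  shows "poly a x = \<gamma>' * poly b x \<longleftrightarrow> x = \<alpha>' \<or> x = \<beta>'"
proof -
  have "poly a x - \<gamma>' * poly b x = poly (a - Polynomial.smult \<gamma>' b) x"
    by simp
  also have "\<dots> = c' * ((x - \<alpha>') ^ s * (x - \<beta>') ^ t)"
    unfolding assms(1) by (simp add: poly_two_point_poly)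
  finally show ?thesis
    using assms(2) s_pos t_pos by (auto simp: algebra_simps)
qed

lemma fibres_disjoint:
  assumes "poly a x = \<gamma>1 * poly b x" "poly a x = \<gamma>2 * poly b x"
  shows "\<gamma>1 = \<gamma>2"
  using assms no_common_root[of x] by auto

lemmas root0 = root_iff[OF fibre c_nonzero]
lemma root1: "poly a x = \<gamma> ^ q * poly b x \<longleftrightarrow> x = \<alpha> ^ q \<or> x = \<beta> ^ q"
  using root_iff[OF fibre1] c_nonzero by simp
lemma root2: "poly a x = \<gamma> ^ (q\<^sup>2) * poly b x \<longleftrightarrow> x = \<alpha> ^ (q\<^sup>2) \<or> x = \<beta> ^ (q\<^sup>2)"
  using root_iff[OF fibre2] c_nonzero by simp

lemma \<gamma>_conj: "\<gamma> ^ q \<noteq> \<gamma>"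
  using \<gamma>_notin by (simp add: in_F_iff)

text \<open>The points \<open>\<alpha> ^ q\<close> and \<open>\<beta> ^ q\<close> lie over
  \<open>\<gamma> ^ q\<close>, whose fibre is disjoint from the one over \<gamma>.\<close>

lemma conj_notin_fibre: "\<alpha> ^ q \<noteq> \<alpha>" "\<alpha> ^ q \<noteq> \<beta>" "\<beta> ^ q \<noteq> \<alpha>" "\<beta> ^ q \<noteq> \<beta>"
  using fibres_disjoint \<gamma>_conj root0 root1 by blast+

lemma \<alpha>_notin: "\<alpha> \<notin> F" and \<beta>_notin: "\<beta> \<notin> F"
  using conj_notin_fibre by (auto simp: in_F_iff)

text \<open>An injective \<open>\<Phi>\<close> permutes the finite set \<open>PF\<close>, so the
  power sums of \<open>conj_quot \<gamma>\<close> can be reindexed along it.\<close>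

lemma sum_\<Phi>_conj_quot:
  assumes "inj_on \<Phi> PF"
  shows "(\<Sum>x\<in>PF. (C * conj_quot \<alpha> x ^ s * conj_quot \<beta> x ^ t) ^ k) = psum \<gamma> k"
proof -
  have "\<Phi> ` PF = PF"
    using \<Phi>_PF assms finite_PF by (intro endo_inj_surj) auto
  then have "psum \<gamma> k = (\<Sum>x\<in>PF. conj_quot \<gamma> (\<Phi> x) ^ k)"
    using sum.reindex[OF assms, of "\<lambda>x. conj_quot \<gamma> x ^ k"] by (simp add: psum_def)
  then show ?thesis
    by (simp add: \<Phi>_conj_quot)
qed

section \<open>Excluding \<gamma> outside the field of order \<open>q\<^sup>2\<close>\<close>

lemma conj2_eq_if_inj:
  assumes inj: "inj_on \<Phi> PF"
  shows "\<gamma> ^ (q\<^sup>2) = \<gamma>"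
proof (rule ccontr)
  assume ne: "\<gamma> ^ (q\<^sup>2) \<noteq> \<gamma>"
  define p where "p = CHAR('k)"
  have p: "Factorial_Ring.prime p" using prime_CHAR by (simp add: p_def)
  have g12: "\<gamma> ^ q \<noteq> \<gamma> ^ (q\<^sup>2)"
    using \<gamma>_conj frob_inj[of \<gamma> "\<gamma> ^ q"] by (simp add: frob_frob)
  have a2: "\<alpha> ^ (q\<^sup>2) \<noteq> \<alpha>" "\<alpha> ^ (q\<^sup>2) \<noteq> \<beta>" "\<beta> ^ (q\<^sup>2) \<noteq> \<alpha>" "\<beta> ^ (q\<^sup>2) \<noteq> \<beta>"
    using fibres_disjoint ne root0 root2 by metis+
  have a12: "\<alpha> ^ (q\<^sup>2) \<noteq> \<alpha> ^ q" "\<alpha> ^ (q\<^sup>2) \<noteq> \<beta> ^ q" "\<beta> ^ (q\<^sup>2) \<noteq> \<alpha> ^ q" "\<beta> ^ (q\<^sup>2) \<noteq> \<beta> ^ q"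
    using fibres_disjoint g12 root1 root2 by metis+
  have "gcd s t \<noteq> 0" "\<not> is_unit p" using s_pos p by auto
  then obtain y where y: "gcd s t = p ^ multiplicity p (gcd s t) * y" "\<not> p dvd y"
    using multiplicity_decompose'[of "gcd s t" p] by blast
  \<comment> \<open>P is the largest power of the characteristic dividing both s and t. After
    division by P at least one exponent is nonzero in the field, as \<open>mason_two_point\<close>
    requires.\<close>
  define P where "P = p ^ multiplicity p (gcd s t)"
  have P: "P > 0" using p by (simp add: P_def prime_gt_0_nat)
  have "P dvd s" "P dvd t" unfolding P_def by (meson dvd_trans gcd_dvd1 gcd_dvd2 multiplicity_dvd)+
  then obtain s0 t0 where st0: "s = P * s0" "t = P * t0" by (auto elim!: dvdE)
  have not_both: "\<not> (p dvd s0 \<and> p dvd t0)"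
  proof
    assume "p dvd s0 \<and> p dvd t0"
    then have "P * p dvd gcd s t" by (auto simp: st0)
    then have "P * p dvd P * y" using y(1) unfolding P_def by metis
    then show False using y P by simp
  qed
  have st0_pos: "s0 > 0" "t0 > 0" using s_pos t_pos by (auto simp: st0)
  define g c' \<alpha>' \<beta>' where "g = (\<lambda>i::nat. \<gamma> ^ (q ^ i))" and "c' = (\<lambda>i::nat. c ^ (q ^ i))"
    and "\<alpha>' = (\<lambda>i::nat. \<alpha> ^ (q ^ i))" and "\<beta>' = (\<lambda>i::nat. \<beta> ^ (q ^ i))"
  have 3: "i = 0 \<or> i = 1 \<or> i = 2" if "i < 3" for i :: nat
    using that by linarith
  have Fi: "a - Polynomial.smult (g i) b =
    Polynomial.smult (c' i) (two_point_poly s t (\<alpha>' i) (\<beta>' i))"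
    if "i < 3" for i
    using 3[OF that] fibre fibre1 fibre2 by (auto simp: g_def c'_def \<alpha>'_def \<beta>'_def frob_frob)
  \<comment> \<open>With these cyclic differences both the sum of the \<open>\<mu> i\<close> and the
    sum of the \<open>\<mu> i * g i\<close> are zero, so a and b are eliminated together.\<close>
  define \<mu> where "\<mu> = (\<lambda>i::nat. if i = 0 then g 1 - g 2 else if i =
    1 then g 2 - g 0 else g 0 - g 1)"
  have \<mu>_nz: "\<mu> i \<noteq> 0" if "i < 3" for i
    using 3[OF that] \<gamma>_conj g12 ne by (auto simp: \<mu>_def g_def)
  \<comment> \<open>With P-th roots as coefficients, the relation becomes the P-th power of one with
    the exponents s0 and t0.\<close>
  have "\<forall>i. \<exists>y. y ^ P = \<mu> i * c' i"
    using nth_root_exists[OF P] by blast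
  from choice[OF this] obtain d where d: "\<And>i. d i ^ P = \<mu> i * c' i" by blast
  have rel: "(\<Sum>i<3. Polynomial.smult (d i) (two_point_poly s0 t0 (\<alpha>' i) (\<beta>' i))) = 0"
  proof -
    have "(\<Sum>i<3. Polynomial.smult (d i) (two_point_poly s0 t0 (\<alpha>' i) (\<beta>' i))) ^ P
        = (\<Sum>i<3. Polynomial.smult (d i) (two_point_poly s0 t0 (\<alpha>' i) (\<beta>' i)) ^ P)"
      using prime_CHAR by (intro freshmans_dream_sum') (simp_all add: P_def p_def)
    also have "\<dots> = (\<Sum>i<3. Polynomial.smult (\<mu> i) (a - Polynomial.smult (g i) b))"
      by (rule sum.cong) (simp_all add: smult_power d Fi st0 two_point_poly_scale)
    also have "\<dots> = 0"
      by (rule Polynomial.poly_eqI) (simp add: eval_nat_numeral \<mu>_def algebra_simps)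
    finally show ?thesis using P by simp
  qed
  have "inj_on \<alpha>' {..<3}" "inj_on \<beta>' {..<3}" "\<And>i j. i < 3 \<Longrightarrow> j < 3 \<Longrightarrow> \<alpha>' i \<noteq> \<beta>' j"
  proof -
    have "i = j" if "\<alpha>' i = \<alpha>' j" "i < 3" "j < 3" for i j
      using 3[OF that(2)] 3[OF that(3)] that(1) conj_notin_fibre a2 a12 by (auto simp: \<alpha>'_def)
    then show "inj_on \<alpha>' {..<3}" by (auto intro: inj_onI)
    have "i = j" if "\<beta>' i = \<beta>' j" "i < 3" "j < 3" for i j
      using 3[OF that(2)] 3[OF that(3)] that(1) conj_notin_fibre a2 a12 by (auto simp: \<beta>'_def)
    then show "inj_on \<beta>' {..<3}" by (auto intro: inj_onI)
    have same: "\<alpha> ^ q \<noteq> \<beta> ^ q" using \<alpha>_neq_\<beta> by (simp add: frob_inj)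
    then have "\<alpha> ^ q\<^sup>2 \<noteq> \<beta> ^ q\<^sup>2" by (simp add: frob_inj flip: frob_frob)
    then show "\<alpha>' i \<noteq> \<beta>' j" if "i < 3" "j < 3" for i j
      using 3[OF that(1)] 3[OF that(2)] conj_notin_fibre a2 a12 \<alpha>_neq_\<beta> same
      by (auto simp: \<alpha>'_def \<beta>'_def)
  qed
  from mason_two_point[OF this st0_pos _ _ rel] not_both \<mu>_nz c_nonzero
  have ps: "\<not> p dvd s0" "\<not> p dvd t0" "s0 + t0 \<le> 4"
    using d P unfolding p_def of_nat_eq_0_iff_char_dvd c'_def
    by (metis mult_eq_0_iff power_eq_0_iff power_not_zero)+
  \<comment> \<open>The same root extraction applies to the first power sum, which vanishes by
    injectivity of \<open>\<Phi>\<close>.\<close>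
  obtain D where D: "D ^ P = C" using nth_root_exists[OF P] by metis
  have "(\<Sum>x\<in>PF. D * conj_quot \<alpha> x ^ s0 * conj_quot \<beta> x ^ t0) ^ P
      = (\<Sum>x\<in>PF. (D * conj_quot \<alpha> x ^ s0 * conj_quot \<beta> x ^ t0) ^ P)"
    using prime_CHAR by (intro freshmans_dream_sum') (simp_all add: P_def p_def)
  also have "\<dots> = (\<Sum>x\<in>PF. (C * conj_quot \<alpha> x ^ s * conj_quot \<beta> x ^ t) ^ 1)"
    by (simp add: power_mult_distrib D st0 mult.commute[of P] flip: power_mult)
  also have "\<dots> = 0"
    using sum_\<Phi>_conj_quot[OF inj, of 1] psum_eq_0[OF \<gamma>_notin, of 1] q_ge_2 by simp
  finally have "(\<Sum>x\<in>PF. D * conj_quot \<alpha> x ^ s0 * conj_quot \<beta> x ^ t0) = 0" by simp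
  then have "D * (\<Sum>x\<in>PF. conj_quot \<alpha> x ^ s0 * conj_quot \<beta> x ^ t0) = 0"
    by (simp add: sum_distrib_left mult.assoc)
  moreover have "D \<noteq> 0" using D C_nonzero P by auto
  ultimately have zero: "(\<Sum>x\<in>PF. conj_quot \<alpha> x ^ s0 * conj_quot \<beta> x ^ t0) = 0" by simp
  \<comment> \<open>If one exponent is 1, the other is at most 3, hence at most q + 1, and the mixed
    sum is nonzero. If both are 2, the characteristic is odd, so 2 divides both t and q + 1.\<close>
  consider "t0 = 1" | "s0 = 1" | "s0 = 2" "t0 = 2"
    using st0_pos ps(3) by linarith
  then show False
  proof cases
    case 1
    then have "mixed_sum \<alpha> \<beta> s0 \<noteq> 0"
      using ps(3) st0_pos q_ge_2 a2 conj_notin_fibre \<alpha>_notin \<beta>_notin \<alpha>_neq_\<beta>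
      by (intro mixed_sum_nonzero) auto
    then show False using zero 1 by (simp add: mixed_sum_def)
  next
    case 2
    then have "mixed_sum \<beta> \<alpha> t0 \<noteq> 0"
      using ps(3) st0_pos q_ge_2 a2 conj_notin_fibre \<alpha>_notin \<beta>_notin \<alpha>_neq_\<beta>
      by (intro mixed_sum_nonzero) auto
    then show False using zero 2 by (simp add: mixed_sum_def mult.commute)
  next
    case 3
    then have "odd p" using ps p by (metis dvd_refl primes_dvd_imp_eq two_is_prime_nat)
    then have "even (q + 1)" by (simp add: q_power p_def)
    moreover have "even t" by (simp add: st0 3)
    ultimately have "2 dvd gcd t (q + 1)" by (intro gcd_greatest)
    then show False unfolding gcd_t by simp
  qed
qed

section \<open>The case of \<gamma> in the field of order \<open>q\<^sup>2\<close>\<close>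

lemma conj2_cases:
  assumes "\<gamma> ^ (q\<^sup>2) = \<gamma>"
  obtains "\<alpha> ^ (q\<^sup>2) = \<alpha>" "\<beta> ^ (q\<^sup>2) = \<beta>" | "\<alpha> ^ (q\<^sup>2) = \<beta>" "\<beta> ^ (q\<^sup>2) = \<alpha>" "s = t"
proof -
  \<comment> \<open>The square of Frobenius maps the fibre injectively into itself, so it fixes or
    swaps the two points.\<close>
  have ab2: "\<alpha> ^ (q\<^sup>2) \<noteq> \<beta> ^ (q\<^sup>2)"
    using \<alpha>_neq_\<beta> by (simp add: frob_inj flip: frob_frob)
  have "\<alpha> ^ (q\<^sup>2) = \<alpha> \<or> \<alpha> ^ (q\<^sup>2) = \<beta>" "\<beta> ^ (q\<^sup>2) = \<alpha> \<or> \<beta> ^ (q\<^sup>2) = \<beta>"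
    using root0 root2 assms by metis+
  then consider "\<alpha> ^ (q\<^sup>2) = \<alpha>" "\<beta> ^ (q\<^sup>2) = \<beta>" | "\<alpha> ^ (q\<^sup>2) = \<beta>" "\<beta> ^ (q\<^sup>2) = \<alpha>"
    using ab2 by auto
  then show ?thesis
  proof cases
    case 1 then show ?thesis using that by blast
  next
    case 2
    \<comment> \<open>After a swap, the order at \<alpha> of one and the same polynomial is t by one
      expression and s by the other.\<close>
    have "Polynomial.smult (c ^ q\<^sup>2) (two_point_poly s t \<beta> \<alpha>) =
      Polynomial.smult c (two_point_poly s t \<alpha> \<beta>)"
      using fibre fibre2 2 assms by (simp add: frob_frob)
    then have "Polynomial.order \<alpha> (Polynomial.smult (c ^ q\<^sup>2) (two_point_poly s t \<beta> \<alpha>)) =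
        Polynomial.order \<alpha> (Polynomial.smult c (two_point_poly s t \<alpha> \<beta>))" by simp
    moreover have "Polynomial.order x (two_point_poly i j x y) = i" if "x \<noteq> y" for i j x and y :: 'k
      using that unfolding two_point_poly_def
      by (subst order_mult) (auto simp: order_power_n_n order_0I)
    ultimately have "s = t"
      using c_nonzero \<alpha>_neq_\<beta> two_point_poly_commute[of s t \<beta> \<alpha>] by (simp add: order_smult)
    then show ?thesis using 2 that by blast
  qed
qed

text \<open>Here \<open>kappa \<delta>\<close> is -1, and the trinomial becomes
  \<open>y ^ Suc q - 1\<close>.\<close>

lemma conj_quot_norm:
  assumes "\<delta> ^ (q\<^sup>2) = \<delta>" "\<delta> \<notin> F" "x \<in> PF"
  shows "conj_quot \<delta> x ^ Suc q = 1"
proof -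
  have "kappa \<delta> = - 1"
    using assms(1,2) by (simp add: kappa_def in_F_iff divide_eq_eq)
  then show ?thesis
    using conj_quot_root[OF assms(2,3)] by simp
qed

text \<open>The inverse is taken in the range 1, ..., q, where the power sums of
  \<open>conj_quot \<gamma>\<close> vanish.\<close>

lemma inverse_exponent:
  obtains t' where "[t * t' = 1] (mod Suc q)" "1 \<le> t'" "t' \<le> q" "coprime t' (Suc q)"
proof -
  have "coprime t (Suc q)" using gcd_t by (simp add: coprime_iff_gcd_eq_1)
  then obtain x where x: "[t * x = 1] (mod Suc q)"
    using cong_solve_coprime_nat by auto
  define t' where "t' = x mod Suc q"
  have 1: "[t * t' = 1] (mod Suc q)"
    using x unfolding t'_def by (simp add: cong_def mod_mult_right_eq)
  then have cop: "coprime t' (Suc q)"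
    using coprime_iff_invertible_nat[of t' "Suc q"] by (auto simp: mult.commute)
  then have "t' \<noteq> 0" using q_ge_2 by (intro notI) simp
  moreover have "t' \<le> q" unfolding t'_def using mod_less_divisor[of "Suc q" x] by linarith
  ultimately show ?thesis using that 1 cop by simp
qed

lemma power_cong_if_norm_1:
  fixes y :: 'k
  assumes "y ^ n = 1" "[i = j] (mod n)"
  shows "y ^ i = y ^ j"
proof -
  have "y ^ i = y ^ (i mod n)" for i
    using power_add[of y "i mod n" "n * (i div n)"] by (simp add: power_mult assms(1))
  then show ?thesis using assms(2) by (metis cong_def)
qed

theorem inj_on_PF_iff: "inj_on \<Phi> PF \<longleftrightarrow> Suc q dvd s \<and> \<gamma> ^ (q\<^sup>2) = \<gamma>"
proof
  assume inj: "inj_on \<Phi> PF"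
  have g2: "\<gamma> ^ (q\<^sup>2) = \<gamma>" by (rule conj2_eq_if_inj[OF inj])
  obtain t' where t': "[t * t' = 1] (mod Suc q)" "1 \<le> t'" "t' \<le> q" "coprime t' (Suc q)"
    by (rule inverse_exponent)
  have zero: "(\<Sum>x\<in>PF. (C * conj_quot \<alpha> x ^ s * conj_quot \<beta> x ^ t) ^ t') = 0"
    using sum_\<Phi>_conj_quot[OF inj, of t'] psum_eq_0[OF \<gamma>_notin, of t'] t' by simp
  have "Suc q dvd s"
    using g2
  proof (cases rule: conj2_cases)
    case 1
    \<comment> \<open>After raising to the power t', the quotient for \<beta> has exponent 1 and the
      one for \<alpha> has exponent r, both modulo q + 1. As r is at most q, the mixed sum can
      vanish only for r = 0.\<close>
    define r where "r = (s * t') mod Suc q"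
    have "(C * conj_quot \<alpha> x ^ s * conj_quot \<beta> x ^ t) ^ t' =
      C ^ t' * (conj_quot \<alpha> x ^ r * conj_quot \<beta> x)"
      if "x \<in> PF" for x
    proof -
      have "conj_quot \<alpha> x ^ (s * t') = conj_quot \<alpha> x ^ r"
        using conj_quot_norm[OF 1(1) \<alpha>_notin that]
        by (rule power_cong_if_norm_1) (simp add: r_def cong_def)
      moreover have "conj_quot \<beta> x ^ (t * t') = conj_quot \<beta> x ^ 1"
        using conj_quot_norm[OF 1(2) \<beta>_notin that] t'(1) by (rule power_cong_if_norm_1)
      ultimately show ?thesis by (simp add: power_mult_distrib flip: power_mult)
    qed
    then have "C ^ t' * mixed_sum \<alpha> \<beta> r = 0"
      using zero by (simp add: mixed_sum_def sum_distrib_left)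
    then have "mixed_sum \<alpha> \<beta> r = 0" using C_nonzero by simp
    moreover have "r \<le> q" unfolding r_def using mod_less_divisor[of "Suc q" "s * t'"] by linarith
    ultimately have "r = 0"
      using mixed_sum_nonzero[OF \<alpha>_notin \<beta>_notin \<alpha>_neq_\<beta>, of r] conj_notin_fibre by fastforce
    then have "Suc q dvd s * t'" by (simp add: r_def mod_eq_0_iff_dvd)
    then show ?thesis using t'(4) by (simp add: coprime_dvd_mult_left_iff coprime_commute)
  next
    case 2
    have "(C * conj_quot \<alpha> x ^ s * conj_quot \<beta> x ^ t) ^ t' =
      C ^ t' * (conj_quot \<alpha> x ^ 1 * conj_quot \<beta> x)"
      if "x \<in> PF" for x
    proof -
      \<comment> \<open>The single quotients need not be roots of unity of order dividing q + 1, but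
        their product is: Frobenius exchanges its numerator and denominator.\<close>
      have "(conj_quot \<alpha> x * conj_quot \<beta> x) ^ Suc q = 1"
      proof (cases x)
        case (Aff z)
        then have z: "z \<in> F" "z ^ q = z" using that by (auto simp: PF_def in_F_iff)
        have ne: "z - \<alpha> \<noteq> 0" "z - \<beta> \<noteq> 0" using z \<alpha>_notin \<beta>_notin by auto
        have "(z - \<alpha> ^ q) \<noteq> 0" "(z - \<beta> ^ q) \<noteq> 0"
          using z \<alpha>_notin \<beta>_notin frob_inj[of z \<alpha>] frob_inj[of z \<beta>] by auto
        then show ?thesis
          using ne by (simp add: Aff power_mult_distrib power_divide frob_diff z frob_frob 2)
      qed simp
      then have "(conj_quot \<alpha> x * conj_quot \<beta> x) ^ (t * t') = (conj_quot \<alpha> x * conj_quot \<beta> x) ^ 1"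
        using t'(1) by (rule power_cong_if_norm_1)
      then show ?thesis using 2 by (simp add: power_mult_distrib flip: power_mult)
    qed
    then have "C ^ t' * mixed_sum \<alpha> \<beta> 1 = 0"
      using zero by (simp add: mixed_sum_def sum_distrib_left)
    \<comment> \<open>The sum cannot vanish here, so swapped points contradict injectivity.\<close>
    moreover have "mixed_sum \<alpha> \<beta> 1 \<noteq> 0"
      using mixed_sum_nonzero[OF \<alpha>_notin \<beta>_notin \<alpha>_neq_\<beta>, of 1] conj_notin_fibre q_ge_2 by fastforce
    ultimately show ?thesis using C_nonzero by simp
  qed
  with g2 show "Suc q dvd s \<and> \<gamma> ^ (q\<^sup>2) = \<gamma>" by simp
next
  assume *: "Suc q dvd s \<and> \<gamma> ^ (q\<^sup>2) = \<gamma>"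
  then have "\<gamma> ^ (q\<^sup>2) = \<gamma>" ..
  then have "\<alpha> ^ (q\<^sup>2) = \<alpha> \<and> \<beta> ^ (q\<^sup>2) = \<beta>"
  proof (cases rule: conj2_cases)
    \<comment> \<open>A swap forces s = t, and then q + 1 divides \<open>gcd t (q + 1)\<close>,
      which is 1.\<close>
    case 2
    then have "Suc q dvd gcd t (q + 1)" using * by simp
    then show ?thesis using gcd_t q_ge_2 by simp
  qed simp
  then have ab: "\<alpha> ^ (q\<^sup>2) = \<alpha>" "\<beta> ^ (q\<^sup>2) = \<beta>" by simp_all
  obtain t' where t': "[t * t' = 1] (mod Suc q)"
    by (rule inverse_exponent)
  \<comment> \<open>The factor from \<alpha> disappears. What remains is the t-th power of a
    quotient whose (q + 1)-th power is 1, and raising to t' undoes it.\<close>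
  have A: "conj_quot \<alpha> x ^ s = 1" if "x \<in> PF" for x
  proof -
    have "[s = 0] (mod Suc q)" using * by (simp add: cong_0_iff)
    then show ?thesis
      using power_cong_if_norm_1[OF conj_quot_norm[OF ab(1) \<alpha>_notin that]] by fastforce
  qed
  show "inj_on \<Phi> PF"
  proof (rule inj_onI)
    fix x y assume xy: "x \<in> PF" "y \<in> PF" "\<Phi> x = \<Phi> y"
    then have "C * conj_quot \<beta> x ^ t = C * conj_quot \<beta> y ^ t"
      using \<Phi>_conj_quot[OF xy(1)] \<Phi>_conj_quot[OF xy(2)] A[OF xy(1)] A[OF xy(2)] xy(3)
      by (metis mult_1_right)
    then have "conj_quot \<beta> x ^ t = conj_quot \<beta> y ^ t" using C_nonzero by simp
    then have "conj_quot \<beta> x ^ (t * t') = conj_quot \<beta> y ^ (t * t')" by (simp add: power_mult)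
    then have "conj_quot \<beta> x = conj_quot \<beta> y"
      using power_cong_if_norm_1[OF conj_quot_norm[OF ab(2) \<beta>_notin xy(1)] t']
        power_cong_if_norm_1[OF conj_quot_norm[OF ab(2) \<beta>_notin xy(2)] t'] by simp
    then show "x = y"
      using conj_quot_inj[OF \<beta>_notin] xy by (auto dest: inj_onD)
  qed
qed

end


section \<open>Lowest terms and ramification indices\<close>

text \<open>By division with remainder, a nonzero element of least degree in the ideal generated by
  a and b divides all of its elements. As a common divisor of a and b it is a unit.\<close>

lemma field_poly_bezout:
  fixes a b :: "'a::field poly"
  assumes "coprime a b"
  obtains u v where "u * a + v * b = 1"
proof -
  define S where "S = {u * a + v * b | u v. True}"
  have S_diff: "x - z * y \<in> S" if xy: "x \<in> S" "y \<in> S" for x y z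
  proof -
    from xy obtain u v u' v' where "x = u * a + v * b" "y = u' * a + v' * b"
      by (auto simp: S_def)
    then have "x - z * y = (u - z * u') * a + (v - z * v') * b"
      by (simp add: algebra_simps)
    then show ?thesis unfolding S_def by blast
  qed
  have aS: "a \<in> S" and bS: "b \<in> S"
    unfolding S_def by (force intro: exI[of _ 1] exI[of _ 0])+
  have "\<exists>d. d \<in> S \<and> d \<noteq> 0"
    using aS bS assms by (metis coprime_0_left_iff not_is_unit_0)
  then obtain d where d: "d \<in> S" "d \<noteq> 0"
    and min: "\<And>y. y \<in> S \<and> y \<noteq> 0 \<Longrightarrow> Polynomial.degree d \<le> Polynomial.degree y"
    using ex_has_least_nat[of "\<lambda>d. d \<in> S \<and> d \<noteq> 0" _ Polynomial.degree] by blast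
  have "d dvd x" if "x \<in> S" for x
  proof -
    have "x mod d \<in> S"
      using S_diff[OF that d(1), of "x div d"] by (simp add: minus_div_mult_eq_mod)
    then have "x mod d = 0"
      using min[of "x mod d"] degree_mod_less[OF d(2), of x] by force
    then show ?thesis by (simp add: dvd_eq_mod_eq_0)
  qed
  then have "is_unit d"
    using assms aS bS by (auto simp: coprime_def)
  then obtain e where "1 = d * e" by (rule dvdE)
  moreover obtain u v where "d = u * a + v * b" using d by (auto simp: S_def)
  ultimately have "(e * u) * a + (e * v) * b = 1"
    by (simp add: algebra_simps)
  then show ?thesis by (rule that)
qed

lemma coprime_if_bezout:
  fixes a b u v :: "'a::field poly"
  assumes "u * a + v * b = 1"
  shows "coprime a b"
  by (rule coprimeI) (metis assms dvd_add dvd_mult)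

text \<open>Take a denominator of least degree: a nonconstant common factor could be cancelled to
  lower the degree. Then scale by the inverse of the leading coefficient.\<close>

lemma fract_lowest_terms_exists:
  fixes f :: "'a::field poly fract"
  obtains a b where "f = Fraction_Field.Fract a b" "coprime a b" "lead_coeff b = 1"
proof -
  obtain a0 b0 where "f = Fraction_Field.Fract a0 b0" "b0 \<noteq> 0"
    by (cases f rule: Fract_cases) auto
  then obtain b where b: "\<exists>a. f = Fraction_Field.Fract a b" "b \<noteq> 0"
    and min: "\<And>y. (\<exists>a. f = Fraction_Field.Fract a y) \<and> y \<noteq> 0
      \<Longrightarrow> Polynomial.degree b \<le> Polynomial.degree y"
    using ex_has_least_nat[of "\<lambda>b. (\<exists>a. f =
      Fraction_Field.Fract a b) \<and> b \<noteq> 0" _ Polynomial.degree] by blast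
  from b obtain a where a: "f = Fraction_Field.Fract a b" by blast
  have "coprime a b"
  proof (rule coprimeI)
    fix c assume "c dvd a" "c dvd b"
    then obtain a' b' where ab: "a = c * a'" "b = c * b'" by (auto elim!: dvdE)
    then have "b' \<noteq> 0" "c \<noteq> 0" using b by auto
    then have "f = Fraction_Field.Fract a' b'"
      using a by (simp add: ab eq_fract)
    then have "Polynomial.degree b \<le> Polynomial.degree b'"
      using min[of b'] \<open>b' \<noteq> 0\<close> by auto
    then have "Polynomial.degree c = 0"
      using \<open>b' \<noteq> 0\<close> \<open>c \<noteq> 0\<close> by (simp add: ab degree_mult_eq)
    then show "is_unit c"
      using \<open>c \<noteq> 0\<close> by (simp add: is_unit_iff_degree)
  qed
  define k where "k = [:inverse (lead_coeff b):]"
  have k: "is_unit k" "k \<noteq> 0" using b by (auto simp: k_def is_unit_iff_degree)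
  have "f = Fraction_Field.Fract (k * a) (k * b)"
    using a b k by (simp add: eq_fract)
  moreover have "coprime (k * a) (k * b)"
    using \<open>coprime a b\<close> k unfolding coprime_def by (metis dvd_mult_unit_iff')
  moreover have "lead_coeff (k * b) = 1"
    using b by (simp add: k_def)
  ultimately show ?thesis by (rule that)
qed

text \<open>Cross multiplication and coprimality make each denominator divide the other, and both
  are monic.\<close>

lemma lowest_terms_unique:
  fixes a b a' b' :: "'a::field poly"
  assumes "Fraction_Field.Fract a b = Fraction_Field.Fract a' b'"
    and "coprime a b" "lead_coeff b = 1" "coprime a' b'" "lead_coeff b' = 1"
  shows "a = a'" "b = b'"
proof -
  have nz: "b \<noteq> 0" "b' \<noteq> 0" using assms by auto
  then have eq: "a * b' = a' * b" using assms(1) by (simp add: eq_fract)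
  have dvd: "b dvd b'" if "coprime a b" "a * b' = a' * b" for a b a' b' :: "'a poly"
  proof -
    obtain u v where "u * a + v * b = 1" using field_poly_bezout[OF \<open>coprime a b\<close>] .
    then have "b' = u * (a * b') + v * b * b'"
      by (metis distrib_right mult.assoc mult_1)
    also have "\<dots> = b * (u * a' + v * b')" by (simp add: that(2) algebra_simps)
    finally show ?thesis by (rule dvdI)
  qed
  have "b dvd b'" "b' dvd b" using dvd assms(2,4) eq by metis+
  then have "Polynomial.degree b = Polynomial.degree b'"
    using nz by (metis dvd_imp_degree_le le_antisym)
  moreover from \<open>b dvd b'\<close> obtain k where k: "b' = b * k" by (rule dvdE)
  ultimately have "Polynomial.degree k = 0"
    using nz by (auto simp: degree_mult_eq)
  then obtain l where "k = [:l:]" by (rule degree_eq_zeroE)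
  moreover from this have "l \<noteq> 0" using k nz by auto
  ultimately show "b = b'"
    using k assms(3,5) by simp
  then show "a = a'" using eq nz by simp
qed

lemma numer_denom_eqI:
  fixes f :: "'a::field poly fract"
  assumes "f = Fraction_Field.Fract a b" "coprime a b" "lead_coeff b = 1"
  shows "numer f = a" "denom f = b"
proof -
  have "lowest_terms f = (a, b)"
    unfolding lowest_terms_def
  proof (rule the_equality)
    fix ab assume *: "case ab of (a, b) \<Rightarrow> f =
      Fraction_Field.Fract a b \<and> coprime a b \<and> lead_coeff b = 1"
    obtain a' b' where ab: "ab = (a', b')" by (cases ab)
    with * assms(1) have "Fraction_Field.Fract a b =
      Fraction_Field.Fract a' b'" "coprime a' b'" "lead_coeff b' = 1"
      by simp_all
    from lowest_terms_unique[OF this(1) assms(2,3) this(2,3)] show "ab = (a, b)"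
      by (simp add: ab)
  qed (use assms in simp)
  then show "numer f = a" "denom f = b" by (simp_all add: numer_def denom_def)
qed

lemma
  fixes f :: "'a::field poly fract"
  shows Fract_numer_denom: "Fraction_Field.Fract (numer f) (denom f) = f"
    and coprime_numer_denom: "coprime (numer f) (denom f)"
    and lead_coeff_denom: "lead_coeff (denom f) = 1"
proof -
  obtain a b where "f = Fraction_Field.Fract a b" "coprime a b" "lead_coeff b = 1"
    by (rule fract_lowest_terms_exists)
  then show "Fraction_Field.Fract (numer f) (denom f) = f" "coprime (numer f) (denom f)"
    "lead_coeff (denom f) = 1"
    using numer_denom_eqI by metis+
qed

lemma denom_nonzero [simp]: "denom (f :: 'a::field poly fract) \<noteq> 0"
  using lead_coeff_denom[of f] by auto

text \<open>Ramification indices are read off from factorisations of elements of \<open>K(X)\<close> as a power of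
  \<open>X\<close> times an element that is regular and nonzero at \<open>0\<close>; this avoids homogenisation.\<close>

definition has_value_at_0 :: "'a::field poly fract \<Rightarrow> 'a \<Rightarrow> bool" where
  "has_value_at_0 f c \<longleftrightarrow> (\<exists>P Q. f = Fraction_Field.Fract P Q \<and> poly Q 0 \<noteq> 0 \<and> poly P 0 =
    c * poly Q 0)"

lemma has_value_at_0_Fract:
  "poly Q 0 \<noteq> 0 \<Longrightarrow> has_value_at_0 (Fraction_Field.Fract P Q) (poly P 0 / poly Q 0)"
  unfolding has_value_at_0_def by (intro exI[of _ P] exI[of _ Q]) simp

lemma has_value_at_0_const: "has_value_at_0 (rat_const c) c"
  unfolding has_value_at_0_def rat_const_def to_fract_def
  by (intro exI[of _ "[:c:]"] exI[of _ 1]) simp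

lemma has_value_at_0_add:
  assumes "has_value_at_0 f c" "has_value_at_0 g d"
  shows "has_value_at_0 (f + g) (c + d)"
proof -
  obtain P Q P' Q' where "f = Fraction_Field.Fract P Q" "poly Q 0 \<noteq> 0" "poly P 0 = c * poly Q 0"
    "g = Fraction_Field.Fract P' Q'" "poly Q' 0 \<noteq> 0" "poly P' 0 = d * poly Q' 0"
    using assms by (auto simp: has_value_at_0_def)
  moreover from this have "Q \<noteq> 0" "Q' \<noteq> 0" by auto
  ultimately show ?thesis unfolding has_value_at_0_def
    by (intro exI[of _ "P * Q' + P' * Q"] exI[of _ "Q * Q'"]) (simp add: algebra_simps)
qed

lemma has_value_at_0_mult:
  assumes "has_value_at_0 f c" "has_value_at_0 g d"
  shows "has_value_at_0 (f * g) (c * d)"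
proof -
  obtain P Q P' Q' where "f = Fraction_Field.Fract P Q" "poly Q 0 \<noteq> 0" "poly P 0 = c * poly Q 0"
    "g = Fraction_Field.Fract P' Q'" "poly Q' 0 \<noteq> 0" "poly P' 0 = d * poly Q' 0"
    using assms by (auto simp: has_value_at_0_def)
  then show ?thesis unfolding has_value_at_0_def
    by (intro exI[of _ "P * P'"] exI[of _ "Q * Q'"]) simp
qed

lemma has_value_at_0_inverse:
  assumes "has_value_at_0 f c" "c \<noteq> 0"
  shows "has_value_at_0 (inverse f) (inverse c)"
proof -
  obtain P Q where "f = Fraction_Field.Fract P Q" "poly Q 0 \<noteq> 0" "poly P 0 = c * poly Q 0"
    using assms by (auto simp: has_value_at_0_def)
  with assms(2) show ?thesis unfolding has_value_at_0_def
    by (intro exI[of _ Q] exI[of _ P]) simp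
qed

lemma has_value_at_0_divide:
  "has_value_at_0 f c \<Longrightarrow> has_value_at_0 g d \<Longrightarrow> d \<noteq> 0 \<Longrightarrow> has_value_at_0 (f / g) (c / d)"
  unfolding divide_inverse by (intro has_value_at_0_mult has_value_at_0_inverse)

lemma has_value_at_0_power: "has_value_at_0 f c \<Longrightarrow> has_value_at_0 (f ^ n) (c ^ n)"
  using has_value_at_0_const[of 1]
  by (induction n) (auto simp: rat_const_def one_pCons[symmetric] intro: has_value_at_0_mult)

section \<open>Substitution of rational functions into polynomials\<close>

lemma rat_const_0 [simp]: "rat_const 0 = 0"
  and rat_const_1 [simp]: "rat_const 1 = 1"
  and rat_const_add: "rat_const (c + d) = rat_const c + rat_const d"
  and rat_const_diff: "rat_const (c - d) = rat_const c - rat_const d"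
  and rat_const_mult: "rat_const (c * d) = rat_const c * rat_const d"
  by (simp_all add: rat_const_def flip: to_fract_add to_fract_diff to_fract_mult one_pCons)

text \<open>This is the evaluation homomorphism at f into \<open>K(X)\<close>;
  \<open>rat_comp\<close> is a quotient of two of its values.\<close>

definition rat_subst :: "'a::field poly \<Rightarrow> 'a poly fract \<Rightarrow> 'a poly fract" where
  "rat_subst p f = poly (map_poly rat_const p) f"

lemma rat_subst_pCons: "rat_subst (pCons c p) f = rat_const c + f * rat_subst p f"
  by (simp add: rat_subst_def map_poly_pCons)

lemma rat_subst_0 [simp]: "rat_subst 0 f = 0"
  by (simp add: rat_subst_def)

lemma rat_subst_1 [simp]: "rat_subst 1 f = 1"
  by (simp add: rat_subst_pCons one_pCons)

lemma rat_subst_add: "rat_subst (p + r) f = rat_subst p f + rat_subst r f"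
  by (induction p r rule: poly_induct2) (simp_all add: rat_subst_pCons rat_const_add algebra_simps)

lemma rat_subst_diff: "rat_subst (p - r) f = rat_subst p f - rat_subst r f"
  using rat_subst_add[of "p - r" r f] by (simp add: algebra_simps)

lemma rat_subst_smult: "rat_subst (Polynomial.smult c p) f = rat_const c * rat_subst p f"
  by (induction p) (simp_all add: rat_subst_pCons rat_const_mult algebra_simps)

lemma rat_subst_mult: "rat_subst (p * r) f = rat_subst p f * rat_subst r f"
  by (induction p) (simp_all add: rat_subst_pCons rat_subst_add rat_subst_smult algebra_simps)

lemma rat_subst_power: "rat_subst (p ^ n) f = rat_subst p f ^ n"
  by (induction n) (simp_all add: rat_subst_mult)

lemma has_value_at_0_subst:
  "has_value_at_0 f c \<Longrightarrow> has_value_at_0 (rat_subst p f) (poly p c)"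
  using has_value_at_0_const[of "0::'a"]
  by (induction p) (auto simp: rat_subst_pCons intro!: has_value_at_0_add has_value_at_0_mult has_value_at_0_const)

lemma has_value_at_0_nonzero:
  assumes "has_value_at_0 f c" "c \<noteq> 0"
  shows "f \<noteq> 0"
proof -
  obtain P Q where f: "f = Fraction_Field.Fract P Q" "poly Q 0 \<noteq> 0" "poly P 0 = c * poly Q 0"
    using assms by (auto simp: has_value_at_0_def)
  then have "P \<noteq> 0" "Q \<noteq> 0" using assms by auto
  then show ?thesis by (simp add: f Zero_fract_def eq_fract)
qed

lemma lowest_term_degree_mult:
  fixes r :: "'a::field poly"
  assumes "poly r 0 \<noteq> 0"
  shows "lowest_term_degree ([:0, 1:] ^ k * r) = k"
proof -
  have m: "[:0, 1:] ^ k * r = Polynomial.monom 1 k * r" 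
    by (simp add: monom_altdef)
  show ?thesis
    unfolding lowest_term_degree_def m
    by (rule Least_equality)
      (use assms in \<open>auto simp: coeff_monom_mult poly_0_coeff_0 split: if_splits\<close>)
qed

lemma poly_at_0_numer_denom: "\<not> (poly (numer f) x = 0 \<and> poly (denom f) x = 0)"
  for f :: "'a::field poly fract"
proof
  assume *: "poly (numer f) x = 0 \<and> poly (denom f) x = 0"
  obtain u v where "u * numer f + v * denom f = 1"
    using field_poly_bezout[OF coprime_numer_denom] .
  then have "poly (u * numer f + v * denom f) x = 1" by simp
  with * show False by simp
qed

text \<open>The obvious representation with numerator \<open>X ^ k * P\<close> need not be in lowest
  terms. Cross multiplication carries the order at 0 over to \<open>numer\<close>, since
  \<open>denom\<close> cannot vanish at 0 without \<open>numer\<close> vanishing too.\<close>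

lemma lowest_term_degree_numer:
  assumes "has_value_at_0 g c" "c \<noteq> 0"
  shows "lowest_term_degree (numer (to_fract [:0, 1:] ^ k * g)) = k"
proof -
  define f where "f = to_fract [:0, 1:] ^ k * g"
  obtain P Q where g: "g = Fraction_Field.Fract P Q" "poly Q 0 \<noteq> 0" "poly P 0 = c * poly Q 0"
    using assms by (auto simp: has_value_at_0_def)
  have P0: "poly P 0 \<noteq> 0" using g assms by simp
  have "to_fract [:0, 1:] ^ k = to_fract ([:0, 1:] ^ k :: 'a poly)"
    by (induction k) (simp_all only: power_0 power_Suc to_fract_1 to_fract_mult)
  then have "f = Fraction_Field.Fract ([:0, 1:] ^ k * P) Q"
    by (simp add: f_def g to_fract_def)
  then have "Fraction_Field.Fract (numer f) (denom f) = Fraction_Field.Fract ([:0, 1:] ^ k * P) Q"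
    by (simp add: Fract_numer_denom)
  then have eq: "numer f * Q = [:0, 1:] ^ k * (P * denom f)"
    using g(2) by (subst (asm) eq_fract) (auto simp: mult_ac)
  have nz: "numer f * Q \<noteq> 0" using eq P0 by auto
  have d0: "poly (denom f) 0 \<noteq> 0"
  proof
    assume d: "poly (denom f) 0 = 0"
    then have "poly (numer f * Q) 0 = 0" by (simp add: eq)
    then show False using d poly_at_0_numer_denom[of f 0] g by simp
  qed
  have "[:- 0, 1:] ^ k dvd numer f"
  proof -
    have "[:- 0, 1:] ^ k dvd numer f * Q" unfolding eq by simp
    then show ?thesis using nz g
      using order_divides[of 0 k "numer f"] order_divides[of 0 k "numer f * Q"]
      by (simp add: order_mult order_0I)
  qed
  then obtain r where r: "numer f = [:0, 1:] ^ k * r" by (auto elim: dvdE)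
  then have "r * Q = P * denom f" using eq by (simp add: mult.assoc)
  then have "poly r 0 * poly Q 0 \<noteq> 0" using P0 d0 by (metis mult_eq_0_iff poly_mult)
  then show ?thesis
    unfolding f_def[symmetric] r by (intro lowest_term_degree_mult) auto
qed

text \<open>With \<sigma> = N / D in lowest terms, \<open>N - \<alpha> D\<close> has degree at most
  one and no constant term, so it is a multiple of X. The multiple is nonzero, as otherwise \<sigma>
  would be constant.\<close>

lemma rat_degree_1_expand_at_0:
  fixes \<sigma> :: "'a::field poly fract"
  assumes "rat_degree \<sigma> = 1" "rat_eval \<sigma> (Aff 0) = Aff \<alpha>"
  obtains g k where "\<sigma> - rat_const \<alpha> = to_fract [:0, 1:] * g" "has_value_at_0 g k" "k \<noteq> 0"
proof -
  define N D where "N = numer \<sigma>" and "D = denom \<sigma>"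
  have D0: "poly D 0 \<noteq> 0" and N0: "poly N 0 = \<alpha> * poly D 0"
    using assms(2) by (auto simp: N_def D_def split: if_splits)
  have deg: "max (Polynomial.degree N) (Polynomial.degree D) = 1"
    using assms(1) by (simp add: rat_degree_def N_def D_def)
  define k where "k = Polynomial.coeff N 1 - \<alpha> * Polynomial.coeff D 1"
  have ND: "N - Polynomial.smult \<alpha> D = [:0, 1:] * [:k:]"
  proof (rule Polynomial.poly_eqI)
    fix n
    have "Polynomial.coeff N n = 0" "Polynomial.coeff D n = 0" if "n > 1"
      using deg that by (auto intro!: coeff_eq_0)
    moreover have "Polynomial.coeff N 0 = \<alpha> * Polynomial.coeff D 0"
      using N0 by (simp add: poly_0_coeff_0)
    ultimately show "Polynomial.coeff (N - Polynomial.smult \<alpha> D) n =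
      Polynomial.coeff ([:0, 1:] * [:k:]) n"
      by (auto simp: k_def coeff_pCons split: nat.splits)
  qed
  have "k \<noteq> 0"
  proof
    assume "k = 0"
    then have N: "N = Polynomial.smult \<alpha> D" using ND by simp
    obtain u v where "u * N + v * D = 1"
      using field_poly_bezout[OF coprime_numer_denom[of \<sigma>]] unfolding N_def D_def .
    then have "D dvd 1" unfolding N by (metis dvd_add dvd_mult dvd_refl dvd_smult)
    then have "Polynomial.degree D = 0" using is_unit_iff_degree[of D] D0 by force
    then show False using deg N by (simp split: if_splits)
  qed
  have "\<sigma> - rat_const \<alpha> = Fraction_Field.Fract N D - Fraction_Field.Fract [:\<alpha>:] 1"
    by (simp add: N_def D_def Fract_numer_denom rat_const_def to_fract_def)
  also have "\<dots> = Fraction_Field.Fract (N - Polynomial.smult \<alpha> D) D"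
    using D0 by (subst diff_fract) auto
  also have "\<dots> = to_fract [:0, 1:] * Fraction_Field.Fract [:k:] D"
    unfolding ND by (simp add: to_fract_def)
  finally show ?thesis
    using that has_value_at_0_Fract[OF D0, of "[:k:]"] D0 \<open>k \<noteq> 0\<close> by simp
qed

lemma rat_degree_1_zero:
  fixes \<rho> :: "'a::field poly fract"
  assumes "rat_degree \<rho> = 1" "rat_eval \<rho> (Aff \<gamma>) = Aff 0"
  obtains k where "numer \<rho> = Polynomial.smult k [:- \<gamma>, 1:]" "k \<noteq> 0" "poly (denom \<rho>) \<gamma> \<noteq> 0"
proof -
  define N D where "N = numer \<rho>" and "D = denom \<rho>"
  have D0: "poly D \<gamma> \<noteq> 0" and N0: "poly N \<gamma> = 0"
    using assms(2) by (auto simp: N_def D_def split: if_splits)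
  have deg: "max (Polynomial.degree N) (Polynomial.degree D) = 1"
    using assms(1) by (simp add: rat_degree_def N_def D_def)
  obtain r where r: "N = [:- \<gamma>, 1:] * r" using N0 by (metis dvdE poly_eq_0_iff_dvd)
  have "N \<noteq> 0"
  proof
    assume "N = 0"
    then have "is_unit D" using coprime_numer_denom[of \<rho>] by (simp add: N_def D_def)
    then show False using deg \<open>N = 0\<close> is_unit_iff_degree[of D] D0 by force
  qed
  then have "Polynomial.degree N = 1 + Polynomial.degree r"
    unfolding r by (subst degree_mult_eq) auto
  then have "Polynomial.degree r = 0" using deg by linarith
  then obtain k where "r = [:k:]" by (rule degree_eq_zeroE)
  then show ?thesis using that[of k] r D0 \<open>N \<noteq> 0\<close> by (auto simp: N_def D_def)
qed

text \<open>Write \<sigma> as \<open>\<alpha> + X g\<close> with g nonzero at 0. Substitution turns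
  \<open>(X - \<alpha>) ^ s\<close> into \<open>X ^ s * g ^ s\<close>, and all remaining factors of
  the composition are regular and nonzero at 0.\<close>

lemma ram_index_eq:
  fixes h :: "'a::field poly fract"
  assumes fact: "numer h - Polynomial.smult \<gamma> (denom h) = [:- \<alpha>, 1:] ^ s * r" "poly r \<alpha> \<noteq> 0" "s > 0"
  shows "rat_eval h (Aff \<alpha>) = Aff \<gamma>" "ram_index h (Aff \<alpha>) = s"
proof -
  have "poly (numer h - Polynomial.smult \<gamma> (denom h)) \<alpha> = 0"
    using assms by simp
  then have num: "poly (numer h) \<alpha> = \<gamma> * poly (denom h) \<alpha>" by simp
  then have den: "poly (denom h) \<alpha> \<noteq> 0" using poly_at_0_numer_denom[of h \<alpha>] by auto
  show ev: "rat_eval h (Aff \<alpha>) = Aff \<gamma>" using num den by simp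
  have main: "lowest_term_degree (numer (rat_comp \<rho> (rat_comp h \<sigma>))) = s"
    if \<rho>: "rat_degree \<rho> = 1" and \<sigma>: "rat_degree \<sigma> = 1" "rat_eval \<sigma> (Aff 0) = Aff \<alpha>"
      and \<rho>\<gamma>: "rat_eval \<rho> (Aff \<gamma>) = Aff 0" for \<rho> \<sigma>
  proof -
    obtain g k where g: "\<sigma> - rat_const \<alpha> = to_fract [:0, 1:] * g" "has_value_at_0 g k" "k \<noteq> 0"
      using rat_degree_1_expand_at_0[OF \<sigma>] .
    obtain l where l: "numer \<rho> = Polynomial.smult l [:- \<gamma>, 1:]" "l \<noteq> 0" "poly (denom \<rho>) \<gamma> \<noteq> 0"
      using rat_degree_1_zero[OF \<rho> \<rho>\<gamma>] .
    define T where "T = (to_fract [:0, 1:] :: 'a poly fract)"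
    have T0: "has_value_at_0 T 0"
      unfolding has_value_at_0_def T_def to_fract_def
      by (intro exI[of _ "[:0, 1:]"] exI[of _ 1]) simp
    have \<sigma>_eq: "\<sigma> = rat_const \<alpha> + T * g" using g(1) by (simp add: T_def algebra_simps)
    have \<sigma>_val: "has_value_at_0 \<sigma> \<alpha>"
      unfolding \<sigma>_eq using has_value_at_0_add[OF has_value_at_0_const has_value_at_0_mult[OF T0 g(2)], of \<alpha>] by simp
    define H where "H = rat_comp h \<sigma>"
    have H: "H = rat_subst (numer h) \<sigma> / rat_subst (denom h) \<sigma>"
      by (simp add: H_def rat_comp_def rat_subst_def)
    have dv: "has_value_at_0 (rat_subst (denom h) \<sigma>) (poly (denom h) \<alpha>)"
      by (rule has_value_at_0_subst[OF \<sigma>_val])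
    have dnz: "rat_subst (denom h) \<sigma> \<noteq> 0" by (rule has_value_at_0_nonzero[OF dv den])
    have H_val: "has_value_at_0 H \<gamma>"
      using has_value_at_0_divide[OF has_value_at_0_subst[OF \<sigma>_val, of "numer h"] dv den] den
      by (simp add: H num)
    have "H - rat_const \<gamma> =
      rat_subst (numer h - Polynomial.smult \<gamma> (denom h)) \<sigma> / rat_subst (denom h) \<sigma>"
      using dnz by (simp add: H rat_subst_diff rat_subst_smult diff_divide_distrib)
    also have "\<dots> = (\<sigma> - rat_const \<alpha>) ^ s * rat_subst r \<sigma> / rat_subst (denom h) \<sigma>"
      using rat_const_diff[of 0 \<alpha>]
      by (simp add: fact(1) rat_subst_mult rat_subst_power rat_subst_pCons)
    also have "\<dots> = T ^ s * (g ^ s * rat_subst r \<sigma> / rat_subst (denom h) \<sigma>)"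
      by (simp add: g(1) T_def power_mult_distrib)
    finally have Hg: "H - rat_const \<gamma> = T ^ s * (g ^ s * rat_subst r \<sigma> / rat_subst (denom h) \<sigma>)" .
    have "rat_comp \<rho> H = rat_subst (numer \<rho>) H / rat_subst (denom \<rho>) H"
      by (simp add: rat_comp_def rat_subst_def)
    also have "rat_subst (numer \<rho>) H = rat_const l * (H - rat_const \<gamma>)"
      unfolding l(1) rat_subst_smult using rat_const_diff[of 0 \<gamma>] by (simp add: rat_subst_pCons)
    finally have eq: "rat_comp \<rho> H = T ^ s *
        (rat_const l * (g ^ s * rat_subst r \<sigma> / rat_subst (denom h) \<sigma>) / rat_subst (denom \<rho>) H)"
      unfolding Hg by (simp add: mult_ac)
    have "has_value_at_0 (rat_const l * (g ^ s * rat_subst r \<sigma> / rat_subst (denom h) \<sigma>) / rat_subst (denom \<rho>) H)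
      (l * (k ^ s * poly r \<alpha> / poly (denom h) \<alpha>) / poly (denom \<rho>) \<gamma>)"
      by (intro has_value_at_0_divide has_value_at_0_mult has_value_at_0_power has_value_at_0_const
          has_value_at_0_subst g \<sigma>_val H_val den l)
    then show ?thesis
      unfolding H_def[symmetric] eq unfolding T_def
      by (rule lowest_term_degree_numer) (use l g den assms in simp)
  qed
  \<comment> \<open>Translations are admissible choices of \<rho> and \<sigma>, so the condition in
    the definite description determines e.\<close>
  have ex: "rat_degree (to_fract [:c, 1:]) = 1" "rat_eval (to_fract [:c, 1:]) (Aff x) =
    Aff (c + x)" for c x :: 'a
  proof -
    have "numer (to_fract [:c, 1:]) = [:c, 1:]" "denom (to_fract [:c, 1:]) = 1"
      by (rule numer_denom_eqI[of _ _ 1]; simp add: to_fract_def)+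
    then show "rat_degree (to_fract [:c, 1:]) = 1" "rat_eval (to_fract [:c, 1:]) (Aff x) =
      Aff (c + x)"
      by (simp_all add: rat_degree_def)
  qed
  show "ram_index h (Aff \<alpha>) = s"
    unfolding ram_index_def
  proof (rule the_equality)
    show "\<forall>\<rho> \<sigma>. rat_degree \<rho> = 1 \<longrightarrow> rat_degree \<sigma> = 1 \<longrightarrow> rat_eval \<sigma> (Aff 0) = Aff \<alpha> \<longrightarrow>
      rat_eval \<rho> (rat_eval h (Aff \<alpha>)) = Aff 0 \<longrightarrow> s =
        lowest_term_degree (numer (rat_comp \<rho> (rat_comp h \<sigma>)))"
      using main unfolding ev by metis
  next
    fix e
    assume e: "\<forall>\<rho> \<sigma>. rat_degree \<rho> = 1 \<longrightarrow> rat_degree \<sigma> = 1 \<longrightarrow> rat_eval \<sigma> (Aff 0) = Aff \<alpha> \<longrightarrow>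
      rat_eval \<rho> (rat_eval h (Aff \<alpha>)) = Aff 0 \<longrightarrow> e =
        lowest_term_degree (numer (rat_comp \<rho> (rat_comp h \<sigma>)))"
    have *: "rat_eval (to_fract [:\<alpha>, 1:]) (Aff 0) = Aff \<alpha>" "rat_eval (to_fract [:- \<gamma>, 1:]) (Aff \<gamma>) =
      Aff 0"
      by (simp_all only: ex) simp_all
    show "e = s"
      using e[rule_format, OF ex(1) ex(1) *(1), of "- \<gamma>"] *(2) main[OF ex(1) ex(1) *]
      unfolding ev by simp
  qed
qed


section \<open>Finite fields\<close>

lemma field_ring_of_type_algebra_sel:
  "carrier (ring_of_type_algebra :: 'k::field ring) = UNIV"
  "x \<otimes>\<^bsub>(ring_of_type_algebra :: 'k ring)\<^esub> y = x * y"
  "x \<oplus>\<^bsub>(ring_of_type_algebra :: 'k ring)\<^esub> y = x + y"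
  "\<one>\<^bsub>(ring_of_type_algebra :: 'k ring)\<^esub> = 1"
  "\<zero>\<^bsub>(ring_of_type_algebra :: 'k ring)\<^esub> = 0"
  by (simp_all add: ring_of_type_algebra_def)

text \<open>For a prime r dividing the order of the field, Sylow's theorem with exponent 1 gives an
  additive subgroup of order r. Its elements are annihilated by r, so r is the
  characteristic.\<close>

lemma finite_field_card_eq_power:
  obtains m where "CARD('a::{finite, field}) = CHAR('a) ^ m"
proof -
  let ?p = "CHAR('a)"
  have p: "Factorial_Ring.prime ?p"
    by (simp add: prime_CHAR_semidom finite_imp_CHAR_pos)
  interpret R: Ring.ring "ring_of_type_algebra :: 'a ring" by (rule ring_from_type_algebra)
  have only: "r = ?p" if r: "Factorial_Ring.prime r" "r dvd CARD('a)" for r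
  proof (rule ccontr)
    assume "r \<noteq> ?p"
    obtain n where n: "CARD('a) = r ^ 1 * n" using r(2) by (auto elim: dvdE)
    then obtain H where H: "subgroup H (add_monoid (ring_of_type_algebra :: 'a ring))" "card H =
      r ^ 1"
      using sylow_thm[OF r(1) R.a_group, of 1 n]
      by (auto simp: Coset.order_def field_ring_of_type_algebra_sel)
    have add: "x + y \<in> H" if "x \<in> H" "y \<in> H" for x y
      using subgroup.m_closed[OF H(1) that] by (simp add: field_ring_of_type_algebra_sel)
    have "x = 0" if "x \<in> H" for x
    proof -
      \<comment> \<open>Translation by x permutes H, so it preserves the sum of all elements, which
        yields r x = 0.\<close>
      have "(\<lambda>y. x + y) ` H = H"
        using add that by (intro endo_inj_surj) (auto simp: inj_on_def)
      then have "(\<Sum>y\<in>H. y) = (\<Sum>y\<in>H. x + y)"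
        using sum.reindex[of "\<lambda>y. x + y" H "\<lambda>y. y"] by (simp add: inj_on_def)
      then have "of_nat r * x = 0" by (simp add: sum.distrib H(2))
      moreover have "of_nat r \<noteq> (0 :: 'a)"
        using p r \<open>r \<noteq> ?p\<close> primes_dvd_imp_eq unfolding of_nat_eq_0_iff_char_dvd by blast
      ultimately show ?thesis by simp
    qed
    then have "H \<subseteq> {0}" by auto
    then have "card H \<le> 1" using card_mono[of "{0 :: 'a}" H] by simp
    then show False using H(2) prime_gt_1_nat[OF r(1)] by simp
  qed
  have "CARD('a) \<noteq> 0" "\<not> is_unit ?p" using p by auto
  then obtain y where y: "CARD('a) = ?p ^ multiplicity ?p CARD('a) * y" "\<not> ?p dvd y"
    using multiplicity_decompose'[of "CARD('a)" ?p] by blast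
  have "y = 1"
  proof (rule ccontr)
    assume "y \<noteq> 1"
    then obtain r where r: "Factorial_Ring.prime r" "r dvd y" using prime_factor_nat by blast
    then have "r dvd CARD('a)" by (subst y(1)) simp
    then show False using only[OF r(1)] r(2) y(2) by simp
  qed
  then show ?thesis using that y(1) by simp
qed

text \<open>As for Fermat's little theorem: multiplication by a nonzero x permutes the nonzero
  elements of S and so preserves their product.\<close>

lemma power_card_eq_self:
  fixes S :: "'k::field set"
  assumes "finite S" "0 \<in> S" "\<And>x y. x \<in> S \<Longrightarrow> y \<in> S \<Longrightarrow> x * y \<in> S" "x \<in> S"
  shows "x ^ card S = x"
proof (cases "x = 0")
  case True
  then show ?thesis using assms by (auto simp: power_0_left card_eq_0_iff)
next
  case False
  let ?T = "S - {0}"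
  have "(\<lambda>y. x * y) ` ?T = ?T"
    using assms False by (intro endo_inj_surj) (auto simp: inj_on_def)
  then have "(\<Prod>y\<in>?T. y) = (\<Prod>y\<in>?T. x * y)"
    using prod.reindex[of "\<lambda>y. x * y" ?T "\<lambda>y. y"] False by (simp add: inj_on_def)
  also have "\<dots> = x ^ card ?T * (\<Prod>y\<in>?T. y)" by (simp add: prod.distrib)
  finally have "x ^ card ?T = 1" using assms(1) by simp
  moreover have "card S = Suc (card ?T)"
    using card_Suc_Diff1[OF assms(1,2)] by simp
  ultimately show ?thesis by simp
qed

lemma
  fixes n :: nat
  assumes "n \<ge> 2"
  shows finite_power_fixed: "finite {x :: 'k::field. x ^ n = x}"
    and card_power_fixed_le: "card {x :: 'k. x ^ n = x} \<le> n"
proof -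
  let ?P = "Polynomial.monom 1 n - Polynomial.monom 1 1 :: 'k poly"
  have roots: "{x. poly ?P x = 0} = {x. x ^ n = x}"
    by (auto simp: poly_monom)
  have "Polynomial.coeff ?P n = 1" using assms by simp
  then have nz: "?P \<noteq> 0" by (metis Polynomial.coeff_0 zero_neq_one)
  have deg: "Polynomial.degree ?P \<le> n"
    by (rule degree_le) (use assms in auto)
  show "finite {x :: 'k. x ^ n = x}"
    using poly_roots_finite[OF nz] by (simp only: roots)
  show "card {x :: 'k. x ^ n = x} \<le> n"
    using card_poly_roots_bound[OF nz] deg by (simp only: roots)
qed

text \<open>The polynomial \<open>X ^ n - X\<close> splits into linear factors, and a repeated root
  would be a root of its derivative -1.\<close>

lemma card_power_fixed:
  fixes n :: nat
  assumes "n \<ge> 2" "of_nat n = (0 :: 'k::alg_closed_field)"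
  shows "card {x :: 'k. x ^ n = x} = n"
proof -
  let ?P = "Polynomial.monom 1 n - Polynomial.monom 1 1 :: 'k poly"
  have coeff: "Polynomial.coeff ?P n = 1" using assms by simp
  have deg: "Polynomial.degree ?P = n"
    by (intro antisym degree_le le_degree) (use assms in auto)
  have nz: "?P \<noteq> 0" using coeff by (metis Polynomial.coeff_0 zero_neq_one)
  obtain A where A: "size A = n" "?P = Polynomial.smult (lead_coeff ?P) (\<Prod>x\<in>#A. [:- x, 1:])"
    using alg_closed_imp_factorization[OF nz] deg by auto
  have lc: "lead_coeff ?P = 1" using coeff by (simp only: deg)
  have P: "?P = (\<Prod>x\<in>#A. [:- x, 1:])"
    using A(2) unfolding lc by simp
  have count: "count A x \<le> 1" for x
  proof (rule ccontr)
    assume "\<not> count A x \<le> 1"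
    then have "{#x, x#} \<subseteq># A" by (intro mset_subset_eqI) auto
    then obtain B where "A = {#x, x#} + B" by (metis subset_mset.add_diff_inverse)
    then have PB: "?P = [:- x, 1:] * ([:- x, 1:] * (\<Prod>x\<in>#B. [:- x, 1:]))" using P by simp
    have "pderiv ?P = - 1"
      using assms by (simp add: pderiv_diff pderiv_monom one_pCons monom_0)
    moreover have "poly (pderiv ?P) x = 0"
      unfolding PB by (simp add: pderiv_mult del: mult_pCons_left)
    ultimately show False by simp
  qed
  have "A = mset_set (set_mset A)"
  proof (rule multiset_eqI)
    fix x
    have "count A x = 1" if "x \<in># A"
      using that count[of x] count_greater_zero_iff[of A x] by linarith
    then show "count A x = count (mset_set (set_mset A)) x"
      by (cases "x \<in># A") (simp_all add: count_mset_set' not_in_iff)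
  qed
  then have "card (set_mset A) = n" using A(1) by (metis size_mset_set)
  moreover have "set_mset A = {x. x ^ n = x}"
  proof -
    have "x \<in># A \<longleftrightarrow> poly ?P x = 0" for x
      unfolding P by (simp add: poly_prod_mset prod_mset_zero_iff image_iff)
    then show ?thesis by (auto simp: poly_monom)
  qed
  ultimately show ?thesis by simp
qed

text \<open>Additivity makes the fixed points of the n-th power map a subfield. Any subfield with n
  elements consists of such fixed points, and the cardinalities agree.\<close>

lemma subfield_of_card_eq:
  fixes n :: nat
  assumes "n \<ge> 2" "of_nat n = (0 :: 'k::alg_closed_field)"
    and add: "\<And>x y :: 'k. (x + y) ^ n = x ^ n + y ^ n"
  shows "subfield_of_card n = {x :: 'k. x ^ n = x}"
proof -
  let ?R = "ring_of_type_algebra :: 'k ring" and ?S = "{x :: 'k. x ^ n = x}"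
  interpret R: Ring.field ?R by (rule field_from_type_algebra)
  have minus: "\<ominus>\<^bsub>?R\<^esub> x = - x" for x
    by (rule R.minus_equality) (simp_all add: field_ring_of_type_algebra_sel)
  have pow_minus: "(- x :: 'k) ^ n = - (x ^ n)" for x
    using add[of x "- x"] assms(1) by (simp add: power_0_left add_eq_0_iff)
  have "subfield ?S ?R"
  proof (rule R.subfieldI[OF R.subcringI'[OF R.subringI]])
    show "Units (?R\<lparr>carrier := ?S\<rparr>) = ?S - {\<zero>\<^bsub>?R\<^esub>}"
    proof
      show "?S - {\<zero>\<^bsub>?R\<^esub>} \<subseteq> Units (?R\<lparr>carrier := ?S\<rparr>)"
      proof
        fix x assume "x \<in> ?S - {\<zero>\<^bsub>?R\<^esub>}"
        then show "x \<in> Units (?R\<lparr>carrier := ?S\<rparr>)"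
          unfolding Units_def
          by (auto simp: field_ring_of_type_algebra_sel power_inverse intro!: exI[of _ "inverse x"])
      qed
    qed (auto simp: Units_def field_ring_of_type_algebra_sel)
  qed (auto simp: field_ring_of_type_algebra_sel minus pow_minus power_mult_distrib add)
  moreover have card: "card ?S = n" using assms by (intro card_power_fixed)
  moreover have "K = ?S" if K: "subfield K ?R \<and> card K = n" for K
  proof -
    from K have sf: "subfield K ?R" and cK: "card K = n" by auto
    note dom = subdomainE[OF subfield.axioms(1)[OF sf], unfolded field_ring_of_type_algebra_sel]
    have "K \<subseteq> ?S"
    proof
      fix x assume "x \<in> K"
      moreover have "finite K" using cK assms(1) by (intro card_ge_0_finite) simp
      ultimately have "x ^ card K = x"
        using dom(2,6) by (intro power_card_eq_self) blast+
      then show "x \<in> ?S" by (simp add: cK)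
    qed
    then show ?thesis
      using cK card finite_power_fixed[OF assms(1)] by (intro card_subset_eq) simp_all
  qed
  ultimately show ?thesis
    unfolding subfield_of_card_def by (intro the_equality conjI)
qed

text \<open>The image of the finite field already supplies q roots of \<open>X ^ q - X\<close>, so
  there are no others in the closure.\<close>

lemma frobenius_field_to_ac:
  "frobenius_field CARD('a::{finite, field}) (range to_ac :: 'a alg_closure set)"
proof -
  let ?q = "CARD('a)"
  have q2: "?q \<ge> 2"
    using card_mono[of UNIV "{0, 1 :: 'a}"] by simp
  obtain m where m: "?q = CHAR('a) ^ m" by (rule finite_field_card_eq_power)
  have p: "Factorial_Ring.prime CHAR('a)"
    by (simp add: prime_CHAR_semidom finite_imp_CHAR_pos)
  have card: "card (range to_ac :: 'a alg_closure set) = ?q"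
    by (simp add: card_image inj_to_ac)
  have "m \<noteq> 0" using m q2 by (intro notI) simp
  show ?thesis
  proof
    show "(x + y) ^ ?q = x ^ ?q + y ^ ?q" for x y :: "'a alg_closure"
      using freshmans_dream'[of ?q m x y] p m by simp
    show "of_nat ?q = (0 :: 'a alg_closure)"
      unfolding of_nat_eq_0_iff_char_dvd using m \<open>m \<noteq> 0\<close> by simp
    have "range to_ac \<subseteq> {x :: 'a alg_closure. x ^ ?q = x}"
      using power_card_eq_self[of "UNIV :: 'a set"] by (auto simp flip: to_ac_power)
    then show "range to_ac = {x :: 'a alg_closure. x ^ ?q = x}"
      using card card_power_fixed_le[OF q2, where 'k =
        "'a alg_closure"] finite_power_fixed[OF q2, where 'k = "'a alg_closure"]
      by (intro card_seteq) auto
  qed (fact q2 card)+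
qed

text \<open>Dividing out the orders at the two roots leaves a polynomial without roots, which is
  constant over an algebraically closed field.\<close>

lemma poly_two_roots_eq:
  fixes p :: "'k::alg_closed_field poly"
  assumes "\<alpha> \<noteq> \<beta>" "p \<noteq> 0" "\<And>x. poly p x = 0 \<longleftrightarrow> x = \<alpha> \<or> x = \<beta>"
  obtains c i j where "p = Polynomial.smult c (two_point_poly i j \<alpha> \<beta>)" "c \<noteq> 0" "i > 0" "j > 0"
proof -
  define i j where "i = Polynomial.order \<alpha> p" and "j = Polynomial.order \<beta> p"
  have "two_point_poly i j \<alpha> \<beta> dvd p"
    using assms(1,2) by (simp add: two_point_poly_dvd_iff i_def j_def)
  then obtain w where w: "p = two_point_poly i j \<alpha> \<beta> * w" by (rule dvdE)
  have ij: "i > 0" "j > 0"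
    using assms(3)[of \<alpha>] assms(3)[of \<beta>] assms(2) by (auto simp: i_def j_def order_root)
  have "w \<noteq> 0" "two_point_poly i j \<alpha> \<beta> \<noteq> 0" using w assms(2) by auto
  have "Polynomial.order \<alpha> (two_point_poly i j \<alpha> \<beta>) =
    i" "Polynomial.order \<beta> (two_point_poly i j \<alpha> \<beta>) = j"
    using assms(1) unfolding two_point_poly_def
    by (subst order_mult; force simp: order_power_n_n order_0I)+
  then have "Polynomial.order \<alpha> w = 0" "Polynomial.order \<beta> w = 0"
    using i_def j_def assms(2) unfolding w by (simp_all add: order_mult)
  then have "poly w x \<noteq> 0" for x
    using assms(3)[of x] \<open>w \<noteq> 0\<close> by (auto simp: w order_root)
  then have "Polynomial.degree w = 0"
    using alg_closed_imp_poly_has_root[of w] by auto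
  then obtain c where c: "w = [:c:]" by (rule degree_eq_zeroE)
  have p: "p = Polynomial.smult c (two_point_poly i j \<alpha> \<beta>)" unfolding w c by simp
  show ?thesis
    by (rule that[OF p _ ij]) (use c \<open>w \<noteq> 0\<close> in auto)
qed


section \<open>The fibre over a point\<close>

lemma poly_map_poly_hom:
  fixes f :: "'a::comm_ring_1 \<Rightarrow> 'b::comm_ring_1"
  assumes "f 0 = 0" "\<And>x y. f (x + y) = f x + f y" "\<And>x y. f (x * y) = f x * f y"
  shows "poly (map_poly f p) (f x) = f (poly p x)"
  by (induction p) (simp_all add: assms map_poly_pCons)

text \<open>Applied to \<open>to_ac\<close> this compares h with its extension; applied to the q-th
  power map it says that the extension commutes with Frobenius. Degrees are preserved, which the
  value at infinity depends on.\<close>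

lemma rat_eval_map_hom:
  fixes f :: "'a::field \<Rightarrow> 'b::field"
  assumes hom: "f 0 = 0" "\<And>x y. f (x + y) = f x + f y" "\<And>x y. f (x * y) = f x * f y"
    "\<And>x y. f (x / y) = f x / f y" "\<And>x. f x = 0 \<longleftrightarrow> x = 0"
    and H: "numer H = map_poly f (numer h)" "denom H = map_poly f (denom h)"
  shows "rat_eval H (map_proj_line f x) = map_proj_line f (rat_eval h x)"
proof -
  have "rat_degree H = rat_degree h"
    by (simp add: rat_degree_def H degree_map_poly hom)
  then show ?thesis
    by (cases x) (simp_all add: H poly_map_poly_hom[OF hom(1-3)] hom coeff_map_poly Let_def)
qed

text \<open>A Bezout relation survives the extension of the field, and with it coprimality.\<close>

lemma
  fixes h :: "'a::field poly fract"
  shows numer_rat_to_ac: "numer (rat_to_ac h) = map_poly to_ac (numer h)"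
    and denom_rat_to_ac: "denom (rat_to_ac h) = map_poly to_ac (denom h)"
proof -
  obtain u v where uv: "u * numer h + v * denom h = 1"
    using field_poly_bezout[OF coprime_numer_denom] .
  note hom = map_poly_ring_hom[of to_ac, OF to_ac_0 to_ac_add to_ac_mult]
  have "map_poly to_ac u * map_poly to_ac (numer h) + map_poly to_ac v * map_poly to_ac (denom h) =
    1"
    using uv by (simp flip: hom)
  then have "coprime (map_poly to_ac (numer h)) (map_poly to_ac (denom h))"
    by (rule coprime_if_bezout)
  moreover have "lead_coeff (map_poly to_ac (denom h)) = 1"
    using lead_coeff_denom[of h] by (simp add: degree_map_poly coeff_map_poly)
  ultimately show "numer (rat_to_ac h) = map_poly to_ac (numer h)"
    "denom (rat_to_ac h) = map_poly to_ac (denom h)"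
    using numer_denom_eqI[of "rat_to_ac h"] by (simp_all add: rat_to_ac_def)
qed

context frobenius_field
begin

lemma PF_iff: "x \<in> PF \<longleftrightarrow> map_proj_line (\<lambda>z. z ^ q) x = x"
  by (cases x) (auto simp: PF_def in_F_iff)

text \<open>With a and b as homogeneous coordinates, finite points and infinity are treated alike:
  for b = 0 both sides of the second claim are 1.\<close>

lemma conj_quot_fraction:
  assumes "a \<in> F" "b \<in> F" "a \<noteq> 0 \<or> b \<noteq> 0" "\<gamma> \<notin> F"
  shows "a - \<gamma> * b \<noteq> 0"
    and "conj_quot \<gamma> (if b = 0 then Infty else Aff (a / b)) = (a - \<gamma> * b) ^ q / (a - \<gamma> * b)"
proof -
  have ab: "a ^ q = a" "b ^ q = b" using assms by (auto simp: in_F_iff)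
  show nz: "a - \<gamma> * b \<noteq> 0"
  proof
    assume *: "a - \<gamma> * b = 0"
    then have "b \<noteq> 0" using assms(3) by auto
    then have "\<gamma> = a / b" using * by (simp add: field_simps)
    then have "\<gamma> \<in> F" by (simp add: in_F_iff power_divide ab)
    then show False using assms(4) by simp
  qed
  have "(a - \<gamma> * b) ^ q = a - \<gamma> ^ q * b"
    by (simp add: frob_diff power_mult_distrib ab)
  then show "conj_quot \<gamma> (if b = 0 then Infty else Aff (a / b)) = (a - \<gamma> * b) ^ q / (a - \<gamma> * b)"
    using nz by (simp add: divide_simps)
qed

end

lemma inj_on_rat_eval_iff:
  fixes h :: "'a::{finite, field} poly fract"
    and \<alpha> \<beta> g :: "'a alg_closure"
  assumes fib: "{x. rat_eval (rat_to_ac h) x = Aff g} = {u, v}" "u \<noteq> v"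
    and ram: "ram_index (rat_to_ac h) u = s" "ram_index (rat_to_ac h) v = t"
    and st: "s > 0" "t > 0" "gcd t (CARD('a) + 1) = 1"
    and g: "g \<notin> range to_ac"
  shows "inj_on (rat_eval (rat_to_ac h)) (frobenius_field.PF (range to_ac)) \<longleftrightarrow>
    Suc (CARD('a)) dvd s \<and> g ^ (CARD('a)\<^sup>2) = g"
proof -
  define q where "q = CARD('a)"
  define H where "H = rat_to_ac h"
  define a b n where "a = numer H" and "b = denom H" and "n = rat_degree H"
  interpret frobenius_field q "range to_ac :: 'a alg_closure set"
    unfolding q_def by (rule frobenius_field_to_ac)
  obtain m where m: "q = CHAR('a) ^ m" unfolding q_def by (rule finite_field_card_eq_power)
  have ab: "a = map_poly to_ac (numer h)" "b = map_poly to_ac (denom h)"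
    by (simp_all add: a_def b_def H_def numer_rat_to_ac denom_rat_to_ac)
  have coeff_F: "Polynomial.coeff a i \<in> range to_ac" "Polynomial.coeff b i \<in> range to_ac" for i
    by (simp_all add: ab coeff_map_poly)
  have poly_F: "poly a z \<in> range to_ac" "poly b z \<in> range to_ac" if "z \<in> range to_ac" for z
    using that by (auto simp: ab poly_map_poly_hom)
  have fixed: "map_poly (\<lambda>x. x ^ q) a = a" "map_poly (\<lambda>x. x ^ q) b = b"
    by (rule Polynomial.poly_eqI; use coeff_F in \<open>simp add: coeff_map_poly in_F_iff\<close>)+
  have ncr: "\<not> (poly a x = 0 \<and> poly b x = 0)" for x
    unfolding a_def b_def by (rule poly_at_0_numer_denom)
  have frob_H: "rat_eval H (map_proj_line (\<lambda>x. x ^ q) x) =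
    map_proj_line (\<lambda>x. x ^ q) (rat_eval H x)" for x
    by (rule rat_eval_map_hom)
      (use fixed q_ge_2 in \<open>simp_all add: frob_add power_mult_distrib power_divide a_def b_def\<close>)
  have H_PF: "rat_eval H \<in> PF \<rightarrow> PF"
  proof
    fix x assume "x \<in> PF"
    then have "map_proj_line (\<lambda>x. x ^ q) x = x" by (simp only: PF_iff)
    then show "rat_eval H x \<in> PF" using frob_H[of x] by (simp only: PF_iff)
  qed
  \<comment> \<open>Infinity is a rational point and so has a rational image, unlike the points over
    \<open>Aff g\<close>. Hence both points of the fibre are finite.\<close>
  have "rat_eval H Infty \<in> PF" using H_PF by (auto simp: PF_def)
  then have "Aff g \<noteq> rat_eval H Infty"
    using g by (auto simp: PF_def)
  then have "Infty \<notin> {u, v}"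
    unfolding fib(1)[symmetric] H_def by (simp del: rat_eval.simps)
  then have "u \<noteq> Infty" "v \<noteq> Infty" by auto
  then obtain \<alpha> \<beta> where uv: "u = Aff \<alpha>" "v = Aff \<beta>" by (metis proj_line.exhaust)
  then have \<alpha>\<beta>: "\<alpha> \<noteq> \<beta>" using fib(2) by simp
  define f where "f = a - Polynomial.smult g b"
  have roots: "poly f x = 0 \<longleftrightarrow> x = \<alpha> \<or> x = \<beta>" for x
  proof -
    have "poly f x = 0 \<longleftrightarrow> rat_eval H (Aff x) = Aff g"
      using ncr[of x] by (auto simp: f_def a_def b_def field_simps)
    also have "\<dots> \<longleftrightarrow> Aff x \<in> {u, v}"
      unfolding fib(1)[symmetric] H_def by simp
    finally show ?thesis by (simp add: uv)
  qed
  \<comment> \<open>The coefficients of degree n are homogeneous coordinates of the image of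
    infinity. Since g is not rational, the term of degree n in f does not cancel.\<close>
  have "Polynomial.coeff a n \<noteq> 0 \<or> Polynomial.coeff b n \<noteq> 0"
  proof (cases "Polynomial.degree a \<le> Polynomial.degree b")
    case True
    then have "n = Polynomial.degree b" by (simp add: n_def rat_degree_def a_def b_def)
    then show ?thesis by (simp add: b_def)
  next
    case False
    then have "n = Polynomial.degree a" "a \<noteq> 0" by (auto simp: n_def rat_degree_def a_def b_def)
    then show ?thesis by simp
  qed
  note inf = conj_quot_fraction[OF coeff_F(1) coeff_F(2) this g]
  have deg: "Polynomial.degree f = n"
  proof (rule antisym)
    show "Polynomial.degree f \<le> n"
      unfolding f_def by (rule degree_diff_le) (auto simp: n_def rat_degree_def a_def b_def intro: order.trans[OF degree_smult_le])
    show "n \<le> Polynomial.degree f"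
      using inf(1) by (intro le_degree) (simp add: f_def)
  qed
  have "f \<noteq> 0" using inf(1) by (auto simp: f_def)
  then obtain c i j where c: "f =
    Polynomial.smult c (two_point_poly i j \<alpha> \<beta>)" "c \<noteq> 0" "i > 0" "j > 0"
    using poly_two_roots_eq[OF \<alpha>\<beta> _ roots] by metis
  have "ram_index H (Aff \<alpha>) = i"
    by (rule ram_index_eq[of _ g _ _ "Polynomial.smult c ([:- \<beta>, 1:] ^ j)"])
      (use c \<alpha>\<beta> in \<open>simp_all add: f_def a_def b_def two_point_poly_def\<close>)
  moreover have "ram_index H (Aff \<beta>) = j"
    by (rule ram_index_eq[of _ g _ _ "Polynomial.smult c ([:- \<alpha>, 1:] ^ i)"])
      (use c \<alpha>\<beta> in \<open>simp_all add: f_def a_def b_def two_point_poly_def mult.commute\<close>)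
  ultimately have ij: "i = s" "j = t" using ram by (simp_all add: uv H_def)
  \<comment> \<open>That c is the leading coefficient of f gives the identity for
    \<open>conj_quot\<close> at infinity, where the quotients for \<alpha> and \<beta> are both
    1.\<close>
  have c_lead: "c = Polynomial.coeff a n - g * Polynomial.coeff b n"
  proof -
    have "lead_coeff f = c"
      unfolding c(1) using lead_coeff_two_point_poly[of i j \<alpha> \<beta>] c(2) by simp
    then show ?thesis unfolding deg by (simp add: f_def)
  qed
  have quot: "conj_quot g (rat_eval H x) = c ^ q / c * conj_quot \<alpha> x ^ s * conj_quot \<beta> x ^ t"
    if "x \<in> PF" for x
  proof (cases x)
    case Infty
    have "rat_eval H Infty =
        (if Polynomial.coeff b n =
          0 then Infty else Aff (Polynomial.coeff a n / Polynomial.coeff b n))"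
      by (simp add: a_def b_def n_def Let_def)
    then have "conj_quot g (rat_eval H x) = c ^ q / c"
      using inf(2) unfolding Infty c_lead by (simp only:)
    then show ?thesis by (simp add: Infty)
  next
    case (Aff z)
    then have z: "z \<in> range to_ac" using that by (auto simp: PF_def)
    then have zq: "z ^ q = z" by (simp add: in_F_iff)
    have fz: "poly a z - g * poly b z = c * (z - \<alpha>) ^ s * (z - \<beta>) ^ t"
      using arg_cong[OF c(1), of "\<lambda>p. poly p z"]
      by (simp add: f_def poly_two_point_poly ij)
    have "conj_quot g (rat_eval H x) = (poly a z - g * poly b z) ^ q / (poly a z - g * poly b z)"
      using conj_quot_fraction(2)[OF poly_F(1)[OF z] poly_F(2)[OF z] _ g] ncr[of z]
      by (auto simp: Aff a_def b_def)
    also have "\<dots> = c ^ q / c * conj_quot \<alpha> x ^ s * conj_quot \<beta> x ^ t"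
    proof -
      have "((z - \<delta>) ^ k) ^ q = (z - \<delta> ^ q) ^ k" for \<delta> k
        by (metis frob_diff zq power_mult mult.commute)
      then show ?thesis
        unfolding fz by (simp add: Aff power_mult_distrib power_divide)
    qed
    finally show ?thesis .
  qed
  interpret two_point_fibre q "range to_ac" m s t a b "rat_eval H" \<alpha> \<beta> g c "c ^ q / c"
  proof
    show "Factorial_Ring.prime CHAR('a alg_closure)"
      by (simp add: prime_CHAR_semidom finite_imp_CHAR_pos)
  qed (use m fixed ncr c st g \<alpha>\<beta> H_PF quot in \<open>auto simp: f_def ij q_def\<close>)
  show ?thesis
    using inj_on_PF_iff unfolding H_def q_def .
qed

theorem theorem4p1:
  fixes h :: "'a::{finite, field} poly fract"
    and \<gamma> :: "'a alg_closure proj_line"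
    and q s t :: nat
  assumes "q = CARD('a)"
    and "\<forall>c. h \<noteq> rat_const c"
    and "s > 0" and "t > 0"
    and "ram_multiset (rat_to_ac h) \<gamma> = {#s, t#}"
    and "gcd t (q + 1) = 1"
  shows "bij (rat_eval h) \<longleftrightarrow>
           [s = 0] (mod (q + 1)) \<and> \<gamma> \<in> Aff ` (subfield_of_card (q\<^sup>2) - range to_ac)"
proof -
  define H where "H = rat_to_ac h"
  interpret frobenius_field q "range to_ac :: 'a alg_closure set"
    unfolding assms(1) by (rule frobenius_field_to_ac)
  let ?\<iota> = "map_proj_line (to_ac :: 'a \<Rightarrow> _)" and ?\<phi> = "map_proj_line (\<lambda>z :: 'a alg_closure. z ^ q)"
  have PF: "PF = range ?\<iota>"
  proof -
    have "x \<in> PF \<longleftrightarrow> x \<in> range ?\<iota>" for x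
    proof (cases x)
      case (Aff z)
      have "Aff z = ?\<iota> y \<longleftrightarrow> (\<exists>w. y = Aff w \<and> z = to_ac w)" for y by (cases y) auto
      then show ?thesis by (auto simp: Aff PF_def image_iff)
    next
      case Infty
      then show ?thesis by (auto simp: PF_def intro!: range_eqI[of _ _ Infty])
    qed
    then show ?thesis by blast
  qed
  have H_\<iota>: "rat_eval H (?\<iota> x) = ?\<iota> (rat_eval h x)" for x
    by (rule rat_eval_map_hom) (simp_all add: H_def numer_rat_to_ac denom_rat_to_ac)
  have inj_\<iota>: "inj ?\<iota>"
    using inj_to_ac by (rule proj_line.inj_map)
  have "UNIV = insert Infty (range (Aff :: 'a \<Rightarrow> _))"
    by (auto intro: proj_line.exhaust)
  then have "finite (UNIV :: 'a proj_line set)" by (metis finite finite_imageI finite_insert)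
  then have bij_iff: "bij (rat_eval h) \<longleftrightarrow> inj (rat_eval h)"
    by (auto simp: bij_def dest: finite_UNIV_inj_surj)
  also have "\<dots> \<longleftrightarrow> inj_on (rat_eval H) PF"
    unfolding PF by (simp add: inj_on_def H_\<iota> inj_eq[OF inj_\<iota>])
  finally have bij_iff_H: "bij (rat_eval h) \<longleftrightarrow> inj_on (rat_eval H) PF" .
  define Z where "Z = {x. rat_eval H x = \<gamma>}"
  have ram: "image_mset (ram_index H) (mset_set Z) = {#s, t#}"
    using assms(5) by (simp add: ram_multiset_def H_def Z_def)
  have "card Z = 2"
    using arg_cong[OF ram, of size] by simp
  then obtain u0 v0 where Z0: "Z = {u0, v0}" "u0 \<noteq> v0" by (auto simp: card_2_iff)
  have "{#ram_index H u0, ram_index H v0#} = {#s, t#}"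
    using ram Z0 by simp
  then have "ram_index H u0 = s \<and> ram_index H v0 = t \<or> ram_index H v0 = s \<and> ram_index H u0 = t"
    by (auto simp: add_eq_conv_ex add_mset_eq_single)
  \<comment> \<open>A multiset has no order, whereas s and t play different roles, so the two points
    are renamed to match.\<close>
  then obtain u v where Z: "Z = {u, v}" "u \<noteq> v" "ram_index H u = s" "ram_index H v = t"
    using Z0 by blast
  show ?thesis
  proof (cases "\<gamma> \<in> PF")
    case True
    then have "\<gamma> \<notin> Aff ` (subfield_of_card (q\<^sup>2) - range to_ac)"
      by (auto simp: PF_def)
    \<comment> \<open>A bijection would supply a rational point of the fibre. Frobenius permutes the
      fibre and fixes that point, hence also the other one, which is then a second rational
      preimage.\<close>
    moreover have "\<not> bij (rat_eval h)"
    proof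
      assume bij: "bij (rat_eval h)"
      have \<phi>_inj: "inj ?\<phi>"
        by (rule proj_line.inj_map) (simp add: inj_def frob_inj)
      have \<phi>_H: "rat_eval H (?\<phi> x) = ?\<phi> (rat_eval H x)" for x
      proof (rule rat_eval_map_hom)
        show "numer H = map_poly (\<lambda>z. z ^ q) (numer H)" "denom H = map_poly (\<lambda>z. z ^ q) (denom H)"
          by (rule Polynomial.poly_eqI; simp add: H_def numer_rat_to_ac denom_rat_to_ac coeff_map_poly,
              metis in_F_iff rangeI)+
      qed (use q_ge_2 in \<open>simp_all add: frob_add power_mult_distrib power_divide\<close>)
      obtain y where "\<gamma> = ?\<iota> y" using True PF by auto
      moreover obtain x where "y = rat_eval h x" using bij by (metis bij_pointE)
      ultimately have x: "?\<iota> x \<in> Z" "?\<iota> x \<in> PF" by (auto simp: Z_def H_\<iota> PF)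
      obtain y where y: "Z = {?\<iota> x, y}" "y \<noteq> ?\<iota> x" using Z(1,2) x(1) by auto
      have \<phi>x: "?\<phi> (?\<iota> x) = ?\<iota> x" using x(2) PF_iff by blast
      have "y \<in> Z" using y(1) by simp
      then have "?\<phi> y \<in> Z"
        using \<phi>_H[of y] True PF_iff[of \<gamma>] by (simp add: Z_def)
      moreover have "?\<phi> y \<noteq> ?\<iota> x" using y(2) \<phi>x \<phi>_inj by (metis injD)
      ultimately have "y \<in> PF" using y(1) PF_iff by auto
      moreover have "rat_eval H y = rat_eval H (?\<iota> x)"
        using x(1) \<open>y \<in> Z\<close> by (simp add: Z_def)
      ultimately show False
        using bij bij_iff_H x(2) y(2) by (auto dest: inj_onD)
    qed
    ultimately show ?thesis by simp
  next
    case False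
    then obtain g where g: "\<gamma> = Aff g" "g \<notin> range to_ac"
      by (cases \<gamma>) (auto simp: PF_def)
    have "q\<^sup>2 \<ge> 2"
      using q_ge_2 mult_le_mono[of 1 q 2 q] by (simp add: power2_eq_square)
    moreover have "of_nat (q\<^sup>2) = (0 :: 'a alg_closure)" using of_nat_q by simp
    moreover have "(x + y) ^ q\<^sup>2 = x ^ q\<^sup>2 + y ^ q\<^sup>2" for x y :: "'a alg_closure"
      by (simp add: frob_add flip: frob_frob)
    ultimately have sub: "subfield_of_card (q\<^sup>2) = {x :: 'a alg_closure. x ^ q\<^sup>2 = x}"
      by (rule subfield_of_card_eq)
    have "inj_on (rat_eval H) PF \<longleftrightarrow> Suc q dvd s \<and> g ^ q\<^sup>2 = g"
      unfolding H_def assms(1)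
      by (rule inj_on_rat_eval_iff[of h g u v])
        (use Z assms g in \<open>simp_all add: Z_def H_def\<close>)
    then show ?thesis
      unfolding bij_iff_H by (auto simp: g sub cong_0_iff)
  qed
qed

end
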